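(* Let $\Omega\subset\mathbb{R}^N$ be an open set, $N=N_1+\dots+N_k\ge 3$, and let $\lambda=(\lambda_1,\dots,\lambda_k)$, $\alpha_{ij}$, $\sigma_i$, $Q$, $\nabla_\lambda$ and $[[\cdot]]_\lambda$ be as in the context. Let $p>1$ and $\mu_1,\dots,\mu_k,s\in\mathbb{R}$ be such that $s<N_1+\mu_1$ and $$-p\min\{\alpha_{1i},\dots,\alpha_{ki},1\}+s<N_i+\mu_i,\qquad i=1,\dots,k.$$ Put $$\psi(x)=\frac{[[x]]_\lambda^{\,p(1+\sum_{i=1}^k(\sigma_i-1))-s}}{\prod_{i=1}^k|x^{(i)}|^{\,p(\sum_{j=1}^k\alpha_{ji})-\mu_i}}.$$ Then for every $u\in\mathring{W}_\lambda^{1,p}(\Omega,\psi)$, $$\left(\frac{Q-s+\sum_{i=1}^k\sigma_i\mu_i}{p}\right)^p\int_\Omega\frac{\prod_{i=1}^k|x^{(i)}|^{\mu_i}}{[[x]]_\lambda^s}|u(x)|^p\,dx\le\int_\Omega\psi(x)\,|\nabla_\lambda u(x)|^p\,dx.$$ In particular (when the indicated parameter values satisfy $s<N_1+\mu_1$ and $-p\min\{\alpha_{1i},\dots,\alpha_{ki},1\}+s<N_i+\mu_i$ for $i=1,\dots,k$, and for $u\in\mathring{W}_\lambda^{1,p}(\Omega,\psi)$ with the corresponding $\psi$): (i) for $s=p$ and $\mu_1=\dots=\mu_k=0$, $$\left(\frac{Q-p}{p}\right)^p\int_\Omega\frac{|u(x)|^p}{[[x]]_\lambda^p}\,dx\le\int_\Omega\frac{[[x]]_\lambda^{\,p\sum_{i=1}^k(\sigma_i-1)}}{\prod_{i=1}^k\lambda_i(x)^p}|\nabla_\lambda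 u(x)|^p\,dx;$$ (ii) for $s=p(1+\sum_{i=1}^k(\sigma_i-1))$ and $\mu_i=p\sum_{j=1}^k\alpha_{ji}$, $i=1,\dots,k$, $$\left(\frac{Q-p}{p}\right)^p\int_\Omega\frac{\prod_{i=1}^k\lambda_i(x)^p}{[[x]]_\lambda^{\,p(1+\sum_{i=1}^k(\sigma_i-1))}}|u(x)|^p\,dx\le\int_\Omega|\nabla_\lambda u(x)|^p\,dx.$$
   Context: Split $\mathbb{R}^N=\mathbb{R}^{N_1}\times\dots\times\mathbb{R}^{N_k}$ and write $x=(x^{(1)},\dots,x^{(k)})$ with $x^{(i)}=(x^{(i)}_1,\dots,x^{(i)}_{N_i})\in\mathbb{R}^{N_i}$; $|\cdot|$ is the Euclidean norm. Let $\alpha_{ij}\ge 0$ for $1\le j<i\le k$ be real constants and set $\alpha_{ij}=0$ for $j\ge i$ (so in particular $\alpha_{1j}=0$ for all $j$). Define $$\lambda_i(x)=\prod_{j=1}^k|x^{(j)}|^{\alpha_{ij}},\qquad i=1,\dots,k,$$ so $\lambda_1\equiv1$; the functions $\lambda_i$ are assumed pairwise different. Define $\sigma_1=1$ and $\sigma_i=1+\sum_{j=1}^{i-1}\alpha_{ij}\sigma_j$ for $i=2,\dots,k$, and the homogeneous dimension $Q=\sigma_1N_1+\dots+\sigma_kN_k$. For a $C^1$ function $u$, $\nabla_\lambda u=(\lambda_1\nabla_{x^{(1)}}u,\dots,\lambda_k\nabla_{x^{(k)}}u)$, where $\nabla_{x^{(i)}}$ is the gradient in the variables $x^{(i)}$.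 The homogeneous norm $[[\cdot]]_\lambda$ is $$[[x]]_\lambda=\left(\sum_{j=1}^k\Big(\prod_{i\ne j}\lambda_i(x)^2\Big)\sigma_j^2|x^{(j)}|^2\right)^{\frac{1}{2(1+\sum_{i=1}^k(\sigma_i-1))}},\qquad x\in\mathbb{R}^N.$$ For $\psi\in L^1_{loc}(\Omega)$ with $\psi>0$ a.e. in $\Omega$, $\mathring{W}_\lambda^{1,p}(\Omega,\psi)$ denotes the closure of $C_0^1(\Omega)$ (compactly supported $C^1$ functions on $\Omega$) with respect to the norm $\left(\int_\Omega|\nabla_\lambda u(x)|^p\psi(x)\,dx\right)^{1/p}$. *)

theory Defs
  imports "HOL-Analysis.Analysis"
begin

text \<open>
  The splitting of \<open>\<real>\<^sup>N\<close> into \<open>k\<close> factors is given by a map \<open>b\<close> from the coordinates \<open>'n\<close>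
  onto \<open>{1..k}\<close>: the coordinate \<open>a\<close> belongs to the factor number \<open>b a\<close>. The component
  \<open>x\<^sup>(\<^sup>i\<^sup>)\<close> is kept inside \<open>\<real>\<^sup>N\<close>, with zeros in the other coordinates, which
  does not change its Euclidean norm.
\<close>

definition block :: "('n::finite \<Rightarrow> nat) \<Rightarrow> nat \<Rightarrow> real^'n \<Rightarrow> real^'n" where
  "block b i x = (\<chi> a. if b a = i then x $ a else 0)"

definition block_dim :: "('n::finite \<Rightarrow> nat) \<Rightarrow> nat \<Rightarrow> nat" where
  "block_dim b i = card {a. b a = i}"

text \<open>
  In the library \<open>0 powr 0 = 0\<close>. Here an exponent \<open>0\<close> has to mean that the factor is absent.
  For a base \<open>0\<close> and a negative exponent the value is \<open>0\<close>; below this happens on null sets only.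
\<close>

definition rpow :: "real \<Rightarrow> real \<Rightarrow> real" where
  "rpow t a = (if a = 0 then 1 else t powr a)"

definition lam :: "nat \<Rightarrow> (nat \<Rightarrow> nat \<Rightarrow> real) \<Rightarrow> ('n::finite \<Rightarrow> nat) \<Rightarrow> nat \<Rightarrow> real^'n \<Rightarrow> real" where
  "lam k \<alpha> b i x = (\<Prod>j=1..k. rpow (norm (block b j x)) (\<alpha> i j))"

fun sigma :: "(nat \<Rightarrow> nat \<Rightarrow> real) \<Rightarrow> nat \<Rightarrow> real" where
  "sigma \<alpha> i = 1 + (\<Sum>j\<in>{1..<i}. \<alpha> i j * sigma \<alpha> j)"

declare sigma.simps [simp del]

definition hom_dim :: "nat \<Rightarrow> (nat \<Rightarrow> nat \<Rightarrow> real) \<Rightarrow> ('n::finite \<Rightarrow> nat) \<Rightarrow> real" where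
  "hom_dim k \<alpha> b = (\<Sum>i=1..k. sigma \<alpha> i * real (block_dim b i))"

definition hom_norm ::
    "nat \<Rightarrow> (nat \<Rightarrow> nat \<Rightarrow> real) \<Rightarrow> ('n::finite \<Rightarrow> nat) \<Rightarrow> real^'n \<Rightarrow> real" where
  "hom_norm k \<alpha> b x =
     (\<Sum>j=1..k. (\<Prod>i\<in>{1..k} - {j}. (lam k \<alpha> b i x)\<^sup>2) * (sigma \<alpha> j)\<^sup>2 * (norm (block b j x))\<^sup>2)
       powr (1 / (2 * (1 + (\<Sum>i=1..k. sigma \<alpha> i - 1))))"

definition grad_lam ::
    "nat \<Rightarrow> (nat \<Rightarrow> nat \<Rightarrow> real) \<Rightarrow> ('n::finite \<Rightarrow> nat) \<Rightarrow> (real^'n \<Rightarrow> real) \<Rightarrow> real^'n \<Rightarrow> real^'n" where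
  "grad_lam k \<alpha> b u x = (\<chi> a. lam k \<alpha> b (b a) x * frechet_derivative u (at x) (axis a 1))"

text \<open>Functions in \<open>C\<^sub>0\<^sup>1(\<Omega>)\<close>, extended by zero to the whole space.\<close>

definition C01 :: "(real^'n::finite) set \<Rightarrow> (real^'n \<Rightarrow> real) set" where
  "C01 \<Omega> = {u. compact (closure {x. u x \<noteq> 0}) \<and> closure {x. u x \<noteq> 0} \<subseteq> \<Omega> \<and>
     (\<forall>x. u differentiable (at x)) \<and>
     (\<forall>a. continuous_on UNIV (\<lambda>x. frechet_derivative u (at x) (axis a 1)))}"

definition wnorm_pow :: "real \<Rightarrow> (real^'n::finite) set \<Rightarrow> (real^'n \<Rightarrow> real) \<Rightarrow> (real^'n \<Rightarrow> real^'n) \<Rightarrow> ennreal"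
  where "wnorm_pow p \<Omega> \<psi> G = (\<integral>\<^sup>+x\<in>\<Omega>. ennreal (\<psi> x * norm (G x) powr p) \<partial>lebesgue)"

text \<open>
  The closure of \<open>C\<^sub>0\<^sup>1(\<Omega>)\<close> in the weighted gradient norm. The norm involves the gradient only, so
  the closure means the completion, realised by functions: an element is the almost everywhere
  limit \<open>u\<close> of functions \<open>\<phi> n\<close> in \<open>C\<^sub>0\<^sup>1(\<Omega>)\<close> that are Cauchy in the norm, and its
  gradient \<open>\<nabla>\<^sub>\<lambda>u\<close> is the limit \<open>G\<close> of the gradients of \<open>\<phi> n\<close>. (The integral
  may be infinite for some functions in \<open>C\<^sub>0\<^sup>1(\<Omega>)\<close> if \<open>\<psi>\<close> is not locally integrable; these do not
  contribute.) The space is given as the set of pairs \<open>(u, \<nabla>\<^sub>\<lambda>u)\<close>.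
\<close>

definition W0 ::
    "nat \<Rightarrow> (nat \<Rightarrow> nat \<Rightarrow> real) \<Rightarrow> ('n::finite \<Rightarrow> nat) \<Rightarrow> real \<Rightarrow> (real^'n) set \<Rightarrow> (real^'n \<Rightarrow> real) \<Rightarrow>
      ((real^'n \<Rightarrow> real) \<times> (real^'n \<Rightarrow> real^'n)) set" where
  "W0 k \<alpha> b p \<Omega> \<psi> = {(u, G).
     u \<in> borel_measurable (lebesgue_on \<Omega>) \<and> G \<in> borel_measurable (lebesgue_on \<Omega>) \<and>
     wnorm_pow p \<Omega> \<psi> G < \<infinity> \<and>
     (\<exists>\<phi>. (\<forall>n. \<phi> n \<in> C01 \<Omega>) \<and>
        (\<lambda>n. wnorm_pow p \<Omega> \<psi> (\<lambda>x. grad_lam k \<alpha> b (\<phi> n) x - G x)) \<longlonglongrightarrow> 0 \<and>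
        (AE x\<in>\<Omega> in lebesgue. (\<lambda>n. \<phi> n x) \<longlonglongrightarrow> u x))}"

definition hardy_weight ::
    "nat \<Rightarrow> (nat \<Rightarrow> nat \<Rightarrow> real) \<Rightarrow> ('n::finite \<Rightarrow> nat) \<Rightarrow> real \<Rightarrow> real \<Rightarrow> (nat \<Rightarrow> real) \<Rightarrow> real^'n \<Rightarrow> real" where
  "hardy_weight k \<alpha> b p s \<mu> x =
     rpow (hom_norm k \<alpha> b x) (p * (1 + (\<Sum>i=1..k. sigma \<alpha> i - 1)) - s) /
     (\<Prod>i=1..k. rpow (norm (block b i x)) (p * (\<Sum>j=1..k. \<alpha> j i) - \<mu> i))"

definition hardy_params ::
    "nat \<Rightarrow> (nat \<Rightarrow> nat \<Rightarrow> real) \<Rightarrow> ('n::finite \<Rightarrow> nat) \<Rightarrow> real \<Rightarrow> real \<Rightarrow> (nat \<Rightarrow> real) \<Rightarrow> bool" where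
  "hardy_params k \<alpha> b p s \<mu> \<longleftrightarrow>
     s < real (block_dim b 1) + \<mu> 1 \<and>
     (\<forall>i\<in>{1..k}. - p * Min (insert 1 ((\<lambda>j. \<alpha> j i) ` {1..k})) + s < real (block_dim b i) + \<mu> i)"

lemma borel_measurable_lam [measurable]: "lam k \<alpha> b i \<in> borel_measurable borel"
proof -
  have "continuous_on UNIV (block b j)" for j
    unfolding block_def
  proof (intro continuous_on_vec_lambda)
    fix a show "continuous_on UNIV (\<lambda>x. if b a = j then x $ a else 0)"
      by (cases "b a = j") (auto intro!: continuous_intros)
  qed
  then have [measurable]: "block b j \<in> borel_measurable borel" for j
    by (simp add: borel_measurable_continuous_onI)
  have [measurable]: "(\<lambda>x. rpow (norm (block b j x)) c) \<in> borel_measurable borel" for j c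
    unfolding rpow_def by measurable
  show ?thesis
    unfolding lam_def [abs_def] by measurable
qed

lemma C01_W0:
  assumes \<Omega>: "open \<Omega>" and u: "u \<in> C01 \<Omega>" and fin: "wnorm_pow p \<Omega> \<psi> (grad_lam k \<alpha> b u) < \<infinity>"
  shows "(u, grad_lam k \<alpha> b u) \<in> W0 k \<alpha> b p \<Omega> \<psi>"
proof -
  have "continuous_on UNIV u"
    using u unfolding C01_def
    by (auto simp: continuous_on_eq_continuous_at intro: differentiable_imp_continuous_within)
  then have u_meas: "u \<in> borel_measurable (lebesgue_on \<Omega>)"
    by (intro measurable_restrict_space1 measurable_completion) (simp add: borel_measurable_continuous_onI)
  have "(\<lambda>x. frechet_derivative u (at x) (axis a 1)) \<in> borel_measurable borel" for a
    using u unfolding C01_def by (auto intro: borel_measurable_continuous_onI)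
  then have "(\<lambda>x. grad_lam k \<alpha> b u x $ a) \<in> borel_measurable borel" for a
    by (simp add: grad_lam_def)
  then have "grad_lam k \<alpha> b u \<in> borel_measurable borel"
    by (subst borel_measurable_euclidean_space) (auto simp: Basis_vec_def inner_axis)
  then have "grad_lam k \<alpha> b u \<in> borel_measurable (lebesgue_on \<Omega>)"
    by (intro measurable_restrict_space1 measurable_completion) simp
  moreover have "wnorm_pow p \<Omega> \<psi> (\<lambda>x. grad_lam k \<alpha> b u x - grad_lam k \<alpha> b u x) = 0"
    by (simp add: wnorm_pow_def)
  ultimately show ?thesis
    unfolding W0_def using u u_meas fin by (auto intro!: exI [of _ "\<lambda>_. u"])
qed

end

theory Submission
  imports Defs "HOL-Real_Asymp.Real_Asymp"
begin

text \<open>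
  Let \<open>w = \<Prod> \<bar>x\<^sub>i\<bar> powr \<mu>\<^sub>i / [[x]] powr s\<close>, let \<open>\<delta>\<^sub>t x\<close> have the components
  \<open>exp (t \<sigma>\<^sub>i) x\<^sub>i\<close>, and let \<open>T\<close> be the Euler field generating these dilations. Since
  \<open>[[\<delta>\<^sub>t x]] = exp t [[x]]\<close>, one has \<open>\<integral> w (f \<circ> \<delta>\<^sub>t) = exp (- C t) \<integral> w f\<close> with
  \<open>C = Q - s + \<Sum> \<sigma>\<^sub>i \<mu>\<^sub>i\<close>. A one-dimensional Hardy inequality along the orbits
  \<open>t \<mapsto> \<delta>\<^sub>t x\<close>, integrated in \<open>x\<close>, therefore gives
  \<open>\<bar>C / p\<bar> powr p \<integral> w \<bar>\<phi>\<bar> powr p \<le> \<integral> w \<bar>T \<phi>\<bar> powr p\<close>. By Cauchy-Schwarz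
  \<open>\<bar>T \<phi>\<bar> \<le> [[x]] powr (1 + \<Sum> (\<sigma>\<^sub>i - 1)) / \<Prod> \<lambda>\<^sub>i * \<bar>\<nabla>\<^sub>\<lambda> \<phi>\<bar>\<close>, which is where the weight
  \<open>\<psi>\<close> comes from; Fatou's lemma extends the inequality to the completion. The hypotheses do allow
  \<open>C < 0\<close>, and as \<open>(- t) powr p = t powr p\<close> in the library, the inequality has to be proved there
  as well: the orbits are then followed towards the origin.
\<close>

section \<open>Powers with \<open>rpow\<close>, block norms and measurability\<close>

lemma rpow_pos: "t > 0 \<Longrightarrow> rpow t a = t powr a"
  by (simp add: rpow_def)

lemma rpow_nonneg: "rpow t a \<ge> 0"
  by (simp add: rpow_def)

lemma rpow_mult: "c > 0 \<Longrightarrow> rpow (c * t) a = c powr a * rpow t a"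
  by (simp add: rpow_def powr_mult)

lemma measurable_rpow [measurable]:
  assumes "f \<in> borel_measurable M" shows "(\<lambda>x. rpow (f x) a) \<in> borel_measurable M"
  using assms unfolding rpow_def by (cases "a = 0") auto

lemma measurable_block [measurable]: "block b i \<in> borel_measurable borel"
proof -
  have "(\<lambda>x. block b i x $ a) \<in> borel_measurable borel" for a
    by (simp add: block_def)
  then show ?thesis
    by (subst borel_measurable_euclidean_space) (auto simp: Basis_vec_def inner_axis)
qed

lemma measurable_vec_lambda:
  assumes "\<And>a. (\<lambda>x. f x a) \<in> borel_measurable M"
  shows "(\<lambda>x. (\<chi> a. f x a) :: real^'n::finite) \<in> borel_measurable M"
  using assms by (subst borel_measurable_euclidean_space) (auto simp: Basis_vec_def inner_axis)

lemma norm_block_power2: "(norm (block b i x))\<^sup>2 = (\<Sum>a | b a = i. (x $ a)\<^sup>2)"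
proof -
  have "(norm (block b i x))\<^sup>2 = (\<Sum>a\<in>UNIV. if b a = i then (x $ a)\<^sup>2 else 0)"
    unfolding norm_vec_def L2_set_def block_def
    by (subst real_sqrt_pow2) (auto intro!: sum_nonneg sum.cong)
  then show ?thesis
    by (simp add: sum.If_cases)
qed

lemma measurable_hom_norm [measurable]: "hom_norm k \<alpha> b \<in> borel_measurable borel"
  unfolding hom_norm_def[abs_def] by measurable

section \<open>Homogeneity under the anisotropic dilations\<close>

locale block_splitting =
  fixes b :: "'n::finite \<Rightarrow> nat" and k :: nat and \<alpha> :: "nat \<Rightarrow> nat \<Rightarrow> real"
  assumes range_b: "b ` UNIV = {1..k}"
    and alpha_nonneg: "\<And>i j. i \<in> {1..k} \<Longrightarrow> j \<in> {1..k} \<Longrightarrow> \<alpha> i j \<ge> 0"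
    and alpha_upper: "\<And>i j. i \<in> {1..k} \<Longrightarrow> j \<in> {1..k} \<Longrightarrow> j \<ge> i \<Longrightarrow> \<alpha> i j = 0"
begin

lemma b_mem: "b a \<in> {1..k}"
  using range_b by auto

lemma b_surj: "i \<in> {1..k} \<Longrightarrow> \<exists>a. b a = i"
  using range_b by (metis imageE)

lemma one_le_k: "1 \<le> k"
  using b_mem[of undefined] by simp

text \<open>On this set \<open>rpow\<close> of a block norm is the ordinary power and all
  denominators are positive, so values at base \<open>0\<close> cannot interfere. It has full
  measure by \<open>AE_gen\<close>.\<close>

definition gen :: "(real^'n) set" where
  "gen = {x. \<forall>i\<in>{1..k}. block b i x \<noteq> 0}"

text \<open>The exponent of the norm of block \<open>j\<close> in the product of all
  \<open>lam k \<alpha> b i\<close>; see \<open>prod_lam\<close>.\<close>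

definition colsum :: "nat \<Rightarrow> real" where
  "colsum j = (\<Sum>i=1..k. \<alpha> i j)"

text \<open>The degree of \<open>sqrt (hom_sum x)\<close> under \<open>dil\<close>;
  \<open>hom_norm\<close> to the power \<open>M\<close> is this square root.\<close>

definition M :: real where
  "M = 1 + (\<Sum>i=1..k. sigma \<alpha> i - 1)"

abbreviation \<sigma> :: "nat \<Rightarrow> real" where "\<sigma> \<equiv> sigma \<alpha>"

text \<open>The additive parameter makes this a one-parameter group, with orbits defined for all
  real \<open>t\<close> and passing through \<open>x\<close> at \<open>t = 0\<close>.\<close>

definition dil :: "real \<Rightarrow> real^'n \<Rightarrow> real^'n" where
  "dil t x = (\<chi> a. exp (t * \<sigma> (b a)) * x $ a)"

lemma sigma_ge_1: "i \<in> {1..k} \<Longrightarrow> \<sigma> i \<ge> 1"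
proof (induction i rule: less_induct)
  case (less i)
  have "0 \<le> \<alpha> i j * \<sigma> j" if "j \<in> {1..<i}" for j
    using less.IH[of j] less.prems that alpha_nonneg[of i j] by (intro mult_nonneg_nonneg) force+
  then have "0 \<le> (\<Sum>j\<in>{1..<i}. \<alpha> i j * \<sigma> j)"
    by (rule sum_nonneg)
  then show ?case
    by (subst sigma.simps) simp
qed

text \<open>The recursion sums over \<open>j < i\<close> only, but \<alpha> is strictly lower
  triangular, so the sum may run over all blocks. This gives \<open>lam\<close> its degree under
  \<open>dil\<close>.\<close>

lemma sigma_eq: "i \<in> {1..k} \<Longrightarrow> (\<Sum>j=1..k. \<alpha> i j * \<sigma> j) = \<sigma> i - 1"
proof -
  assume i: "i \<in> {1..k}"
  have "(\<Sum>j=1..k. \<alpha> i j * \<sigma> j) = (\<Sum>j\<in>{1..<i}. \<alpha> i j * \<sigma> j)"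
    using i alpha_upper[of i] by (intro sum.mono_neutral_right) auto
  then show ?thesis
    using sigma.simps[of \<alpha> i] by simp
qed

lemma M_ge_1: "M \<ge> 1"
  unfolding M_def using sigma_ge_1 by (auto intro!: sum_nonneg)

text \<open>Interchanging the sums turns the row sums of \<open>sigma_eq\<close> into column
  sums.\<close>

lemma M_eq_colsum: "M = 1 + (\<Sum>j=1..k. colsum j * \<sigma> j)"
proof -
  have "(\<Sum>j=1..k. colsum j * \<sigma> j) = (\<Sum>i=1..k. \<Sum>j=1..k. \<alpha> i j * \<sigma> j)"
    unfolding colsum_def sum_distrib_right by (rule sum.swap)
  also have "\<dots> = (\<Sum>i=1..k. \<sigma> i - 1)"
    by (intro sum.cong refl sigma_eq)
  finally show ?thesis
    unfolding M_def by simp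
qed

lemma block_dil: "block b i (dil t x) = exp (t * \<sigma> i) *\<^sub>R block b i x"
  by (auto simp: block_def dil_def vec_eq_iff)

lemma norm_block_dil: "norm (block b i (dil t x)) = exp (t * \<sigma> i) * norm (block b i x)"
  by (simp add: block_dil)

lemma lam_nonneg: "lam k \<alpha> b i x \<ge> 0"
  unfolding lam_def by (simp add: prod_nonneg rpow_nonneg)

lemma lam_pos: "x \<in> gen \<Longrightarrow> lam k \<alpha> b i x > 0"
  unfolding lam_def gen_def by (intro prod_pos) (auto simp: rpow_pos)

lemma lam_dil:
  assumes "i \<in> {1..k}"
  shows "lam k \<alpha> b i (dil t x) = exp (t * (\<sigma> i - 1)) * lam k \<alpha> b i x"
proof -
  have "lam k \<alpha> b i (dil t x) =
      (\<Prod>j=1..k. exp (t * (\<alpha> i j * \<sigma> j)) * rpow (norm (block b j x)) (\<alpha> i j))"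
    unfolding lam_def norm_block_dil
    by (intro prod.cong refl) (subst rpow_mult, auto simp: powr_def ac_simps)
  also have "\<dots> = exp (t * (\<Sum>j=1..k. \<alpha> i j * \<sigma> j)) * lam k \<alpha> b i x"
    by (simp add: prod.distrib lam_def exp_sum sum_distrib_left)
  finally show ?thesis
    using sigma_eq[OF assms] by simp
qed

definition hom_sum :: "real^'n \<Rightarrow> real" where
  "hom_sum x = (\<Sum>j=1..k. (\<Prod>i\<in>{1..k} - {j}. (lam k \<alpha> b i x)\<^sup>2) * (\<sigma> j)\<^sup>2 * (norm (block b j x))\<^sup>2)"

lemma hom_norm_eq: "hom_norm k \<alpha> b x = hom_sum x powr (1 / (2 * M))"
  by (simp add: hom_norm_def hom_sum_def M_def)

lemma hom_sum_nonneg: "hom_sum x \<ge> 0"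
  unfolding hom_sum_def by (intro sum_nonneg mult_nonneg_nonneg prod_nonneg) auto

lemma hom_sum_pos:
  assumes "x \<in> gen" shows "hom_sum x > 0"
  unfolding hom_sum_def
proof (rule sum_pos)
  fix j assume j: "j \<in> {1..k}"
  then have "block b j x \<noteq> 0" "\<sigma> j > 0"
    using assms sigma_ge_1[OF j] by (auto simp: gen_def)
  then show "(\<Prod>i\<in>{1..k} - {j}. (lam k \<alpha> b i x)\<^sup>2) * (\<sigma> j)\<^sup>2 * (norm (block b j x))\<^sup>2 > 0"
    using lam_pos[OF assms] by (intro mult_pos_pos prod_pos) (auto simp: less_le)
qed (use one_le_k in auto)

lemma hom_norm_pos: "x \<in> gen \<Longrightarrow> hom_norm k \<alpha> b x > 0"
  using hom_sum_pos[of x] by (simp add: hom_norm_eq)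

text \<open>Summand \<open>j\<close> has degree \<open>2 * (M - \<sigma> j)\<close> from the product
  of the \<open>lam\<close> and \<open>2 * \<sigma> j\<close> from its block norm; the total
  \<open>2 * M\<close> does not depend on \<open>j\<close>.\<close>

lemma hom_sum_dil: "hom_sum (dil t x) = exp (2 * M * t) * hom_sum x"
proof -
  have "(\<Prod>i\<in>{1..k} - {j}. (lam k \<alpha> b i (dil t x))\<^sup>2) * (\<sigma> j)\<^sup>2 * (norm (block b j (dil t x)))\<^sup>2
      = exp (2 * M * t) * ((\<Prod>i\<in>{1..k} - {j}. (lam k \<alpha> b i x)\<^sup>2) * (\<sigma> j)\<^sup>2 * (norm (block b j x))\<^sup>2)"
    if j: "j \<in> {1..k}" for j
  proof -
    have "(\<Prod>i\<in>{1..k} - {j}. (lam k \<alpha> b i (dil t x))\<^sup>2)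
        = (\<Prod>i\<in>{1..k} - {j}. exp (2 * t * (\<sigma> i - 1)) * (lam k \<alpha> b i x)\<^sup>2)"
      by (intro prod.cong refl) (auto simp: lam_dil power_mult_distrib mult_ac simp flip: exp_double)
    also have "\<dots> = exp (2 * t * (\<Sum>i\<in>{1..k} - {j}. \<sigma> i - 1)) * (\<Prod>i\<in>{1..k} - {j}. (lam k \<alpha> b i x)\<^sup>2)"
      by (simp add: prod.distrib exp_sum sum_distrib_left)
    also have "(\<Sum>i\<in>{1..k} - {j}. \<sigma> i - 1) = M - \<sigma> j"
      unfolding M_def using j by (subst (2) sum.remove[of _ j]) auto
    finally have A: "(\<Prod>i\<in>{1..k} - {j}. (lam k \<alpha> b i (dil t x))\<^sup>2)
        = exp (2 * t * (M - \<sigma> j)) * (\<Prod>i\<in>{1..k} - {j}. (lam k \<alpha> b i x)\<^sup>2)" .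
    have B: "(norm (block b j (dil t x)))\<^sup>2 = exp (2 * t * \<sigma> j) * (norm (block b j x))\<^sup>2"
      by (simp add: norm_block_dil power_mult_distrib mult_ac flip: exp_double)
    have C: "exp (2 * M * t) = exp (2 * t * (M - \<sigma> j)) * exp (2 * t * \<sigma> j)"
      by (simp add: algebra_simps flip: exp_add)
    show ?thesis
      unfolding A B C by (simp only: mult_ac)
  qed
  then show ?thesis
    unfolding hom_sum_def sum_distrib_left by (intro sum.cong) auto
qed

lemma hom_norm_dil: "hom_norm k \<alpha> b (dil t x) = exp t * hom_norm k \<alpha> b x"
  using M_ge_1 by (simp add: hom_norm_eq hom_sum_dil powr_mult exp_powr_real)

definition hweight :: "real \<Rightarrow> (nat \<Rightarrow> real) \<Rightarrow> real^'n \<Rightarrow> real" where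
  "hweight s \<mu> x = (\<Prod>i=1..k. rpow (norm (block b i x)) (\<mu> i)) / rpow (hom_norm k \<alpha> b x) s"

lemma hweight_nonneg: "hweight s \<mu> x \<ge> 0"
  by (simp add: hweight_def prod_nonneg rpow_nonneg)

lemma measurable_hweight [measurable]: "hweight s \<mu> \<in> borel_measurable borel"
  unfolding hweight_def[abs_def] by measurable

lemma hweight_dil:
  "hweight s \<mu> (dil t x) = exp (t * ((\<Sum>i=1..k. \<sigma> i * \<mu> i) - s)) * hweight s \<mu> x"
proof -
  have "(\<Prod>i=1..k. rpow (norm (block b i (dil t x))) (\<mu> i))
      = (\<Prod>i=1..k. exp (t * (\<sigma> i * \<mu> i)) * rpow (norm (block b i x)) (\<mu> i))"
    unfolding norm_block_dil
    by (intro prod.cong refl) (subst rpow_mult, auto simp: powr_def ac_simps)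
  also have "\<dots> = exp (t * (\<Sum>i=1..k. \<sigma> i * \<mu> i)) * (\<Prod>i=1..k. rpow (norm (block b i x)) (\<mu> i))"
    by (simp add: prod.distrib exp_sum sum_distrib_left)
  finally show ?thesis
    by (simp add: hweight_def hom_norm_dil rpow_mult exp_powr_real exp_diff right_diff_distrib)
qed

text \<open>Every block contains a coordinate, so a vanishing block forces \<open>x\<close> into a
  coordinate hyperplane.\<close>

lemma AE_gen: "AE x in lborel. x \<in> gen"
proof -
  have "AE x in lborel. block b i x \<noteq> 0" if "i \<in> {1..k}" for i
  proof -
    from b_surj[OF that] obtain a where a: "b a = i" by blast
    have "negligible {x::real^'n. x $ a = 0}"
      using negligible_standard_hyperplane[of "axis a (1::real)::real^'n" 0]
      by (simp add: inner_axis axis_in_Basis_iff)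
    moreover have "{x::real^'n. x $ a = 0} \<in> sets borel" by measurable
    ultimately have null: "{x::real^'n. x $ a = 0} \<in> null_sets lborel"
      by (simp add: negligible_iff_null_sets null_sets_completion_iff)
    then have "AE x::real^'n in lborel. x $ a \<noteq> 0"
      using AE_not_in[OF null] by simp
    then show ?thesis
      by eventually_elim (use a in \<open>auto simp: block_def vec_eq_iff\<close>)
  qed
  then show ?thesis
    unfolding gen_def by (simp add: AE_ball_countable)
qed

end

section \<open>Convexity of powers and the Hardy inequality on the half line\<close>

text \<open>The left-hand side is the tangent line at \<open>a\<close>. For \<open>a > 0\<close> the
  bound is Young's inequality for \<open>y\<close> and \<open>a powr (p - 1)\<close> with exponents
  \<open>p\<close> and \<open>p / (p - 1)\<close>.\<close>

lemma powr_tangent_le: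
  fixes a y p :: real
  assumes p: "p > 1" and a: "a \<ge> 0" and y: "y \<ge> 0"
  shows "p * a powr (p - 1) * y - (p - 1) * a powr p \<le> y powr p"
proof (cases "a = 0")
  case True
  then show ?thesis by simp
next
  case False
  then have a0: "a > 0" using a by simp
  define q where "q = p / (p - 1)"
  have q: "q > 1" "1 / p + 1 / q = 1"
    using p by (auto simp: q_def field_simps)
  have "y * a powr (p - 1) \<le> y powr p / p + (a powr (p - 1)) powr q / q"
    using p q y by (intro Youngs_inequality) auto
  also have "(a powr (p - 1)) powr q = a powr p"
    using p by (simp add: powr_powr q_def)
  also have "y powr p / p + a powr p / q = (y powr p + (p - 1) * a powr p) / p"
    using p by (simp add: q_def field_simps)
  finally show ?thesis
    using p by (simp add: field_simps)
qed

text \<open>With weights \<open>1 - \<theta>\<close> and \<theta>, the sum \<open>z = a + c\<close>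
  is the convex combination of \<open>a / (1 - \<theta>)\<close> and \<open>c / \<theta>\<close>;
  the two tangent bounds at \<open>z\<close> are added. For small \<theta> the factor of
  \<open>a powr p\<close> is close to \<open>1\<close>, as the passage to the completion
  needs.\<close>

lemma powr_add_le:
  fixes a c p \<theta> :: real
  assumes p: "p > 1" and a: "a \<ge> 0" and c: "c \<ge> 0" and \<theta>: "0 < \<theta>" "\<theta> < 1"
  shows "(a + c) powr p \<le> (1 - \<theta>) powr (1 - p) * a powr p + \<theta> powr (1 - p) * c powr p"
proof -
  define z where "z = a + c"
  have zp: "z powr (p - 1) * z = z powr p"
    using a c by (cases "z = 0") (auto simp: z_def powr_diff)
  have y1: "p * z powr (p - 1) * (a / (1 - \<theta>)) - (p - 1) * z powr p \<le> (a / (1 - \<theta>)) powr p"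
    by (rule powr_tangent_le) (use p a c \<theta> in \<open>auto simp: z_def\<close>)
  have y2: "p * z powr (p - 1) * (c / \<theta>) - (p - 1) * z powr p \<le> (c / \<theta>) powr p"
    by (rule powr_tangent_le) (use p a c \<theta> in \<open>auto simp: z_def\<close>)
  have "z powr p = p * (z powr (p - 1) * z) - (p - 1) * z powr p"
    unfolding zp by (simp add: algebra_simps)
  also have "\<dots> = (1 - \<theta>) * (p * z powr (p - 1) * (a / (1 - \<theta>)) - (p - 1) * z powr p)
      + \<theta> * (p * z powr (p - 1) * (c / \<theta>) - (p - 1) * z powr p)"
    using \<theta> by (simp add: z_def right_diff_distrib) (simp add: algebra_simps)
  also have "\<dots> \<le> (1 - \<theta>) * (a / (1 - \<theta>)) powr p + \<theta> * (c / \<theta>) powr p"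
    using \<theta> by (intro add_mono mult_left_mono y1 y2) auto
  also have "(1 - \<theta>) * (a / (1 - \<theta>)) powr p = (1 - \<theta>) powr (1 - p) * a powr p"
    using \<theta> by (simp add: powr_divide powr_diff)
  also have "\<theta> * (c / \<theta>) powr p = \<theta> powr (1 - p) * c powr p"
    using \<theta> by (simp add: powr_divide powr_diff)
  finally show ?thesis by (simp add: z_def)
qed

lemma nn_integral_exp_neg:
  assumes "\<kappa> > 0"
  shows "(\<integral>\<^sup>+t. ennreal (exp (- (\<kappa> * t))) * indicator {0..} t \<partial>lborel) = ennreal (1 / \<kappa>)"
proof -
  have "(\<integral>\<^sup>+t. ennreal (exp (- (\<kappa> * t))) * indicator {0..} t \<partial>lborel)
      = ennreal (0 - (- (exp (- (\<kappa> * 0)) / \<kappa>)))"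
  proof (rule nn_integral_FTC_atLeast)
    show "((\<lambda>t. - (exp (- (\<kappa> * t)) / \<kappa>)) \<longlongrightarrow> 0) at_top"
      using assms by real_asymp
  qed (use assms in \<open>auto intro!: derivative_eq_intros\<close>)
  then show ?thesis by simp
qed

text \<open>Integrating the tangent line of \<open>y \<mapsto> y powr p\<close> at \<open>a\<close>, taken at
  \<open>y = exp (\<kappa> t) \<bar>v' t\<bar>\<close>, replaces Hoelder's inequality; the choice \<open>a = \<kappa> \<bar>v 0 - L\<bar>\<close> is optimal.\<close>

lemma hardy_half_line:
  fixes v v' :: "real \<Rightarrow> real"
  assumes p: "p > 1" and \<kappa>: "\<kappa> > 0"
    and der: "\<And>t. (v has_real_derivative v' t) (at t)"
    and cont: "continuous_on UNIV v'"
    and lim: "(v \<longlongrightarrow> L) at_top"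
  shows "ennreal (\<kappa> powr (p - 1) * \<bar>v 0 - L\<bar> powr p) \<le>
    (\<integral>\<^sup>+t. ennreal (exp (\<kappa> * (p - 1) * t) * \<bar>v' t\<bar> powr p) * indicator {0..} t \<partial>lborel)"
    (is "_ \<le> ?I")
proof -
  define d where "d = \<bar>v 0 - L\<bar>"
  define a where "a = \<kappa> * d"
  \<comment> \<open>The sign for which \<open>e * (L - v 0) = d\<close>.\<close>
  define e where "e = (if v 0 \<le> L then 1 else -1 :: real)"
  define h where "h t = exp (\<kappa> * (p - 1) * t) * \<bar>v' t\<bar> powr p" for t
  have h0: "h t \<ge> 0" for t by (simp add: h_def)
  have conth: "continuous_on A h" for A
    unfolding h_def using p
    by (intro continuous_intros continuous_on_powr' continuous_on_subset[OF cont]) auto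
  have hm: "h \<in> borel_measurable borel"
    using conth by (rule borel_measurable_continuous_onI)
  \<comment> \<open>A primitive of \<open>exp (- (\<kappa> * t))\<close> times the tangent line at
    \<open>a\<close>, evaluated at \<open>y = exp (\<kappa> * t) * e * v' t\<close>.\<close>
  define F where "F t = p * a powr (p - 1) * e * v t + (p - 1) * a powr p * exp (- (\<kappa> * t)) / \<kappa>" for t
  have dF: "(F has_real_derivative
      (p * a powr (p - 1) * e * v' t - (p - 1) * a powr p * exp (- (\<kappa> * t)))) (at t)" for t
    unfolding F_def using \<kappa> by (auto intro!: derivative_eq_intros der)
  have a0: "a \<ge> 0" using \<kappa> by (simp add: a_def d_def)
  have le: "p * a powr (p - 1) * e * v' t - (p - 1) * a powr p * exp (- (\<kappa> * t)) \<le> h t" for t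
  proof -
    have "p * a powr (p - 1) * (exp (\<kappa> * t) * \<bar>v' t\<bar>) - (p - 1) * a powr p
        \<le> (exp (\<kappa> * t) * \<bar>v' t\<bar>) powr p"
      by (rule powr_tangent_le) (use p a0 in auto)
    then have "exp (- (\<kappa> * t)) * (p * a powr (p - 1) * (exp (\<kappa> * t) * \<bar>v' t\<bar>) - (p - 1) * a powr p)
        \<le> exp (- (\<kappa> * t)) * (exp (\<kappa> * t) * \<bar>v' t\<bar>) powr p"
      by (intro mult_left_mono) auto
    also have "(exp (\<kappa> * t) * \<bar>v' t\<bar>) powr p = exp (\<kappa> * t * p) * \<bar>v' t\<bar> powr p"
      by (simp add: powr_mult exp_powr_real)
    also have "exp (- (\<kappa> * t)) * (exp (\<kappa> * t * p) * \<bar>v' t\<bar> powr p) = h t"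
    proof -
      have "exp (- (\<kappa> * t)) * exp (\<kappa> * t * p) = exp (\<kappa> * (p - 1) * t)"
        by (simp add: algebra_simps flip: exp_add)
      then show ?thesis by (simp add: h_def flip: mult.assoc)
    qed
    also have "exp (- (\<kappa> * t)) * (p * a powr (p - 1) * (exp (\<kappa> * t) * \<bar>v' t\<bar>) - (p - 1) * a powr p)
        = p * a powr (p - 1) * \<bar>v' t\<bar> - (p - 1) * a powr p * exp (- (\<kappa> * t))"
      by (simp add: exp_minus field_simps)
    finally have *: "p * a powr (p - 1) * \<bar>v' t\<bar> - (p - 1) * a powr p * exp (- (\<kappa> * t)) \<le> h t" .
    have "p * a powr (p - 1) * (e * v' t) \<le> p * a powr (p - 1) * \<bar>v' t\<bar>"
      using p by (intro mult_left_mono) (auto simp: e_def)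
    with * show ?thesis by (simp add: mult.assoc)
  qed
  \<comment> \<open>Only the limit of \<open>v\<close> is known, so the fundamental theorem is
    applied on \<open>{0..T}\<close> first and \<open>T\<close> tends to infinity
    afterwards.\<close>
  have fin: "ennreal (F T - F 0) \<le> ?I" if T: "T \<ge> 0" for T
  proof -
    have "((\<lambda>t. p * a powr (p - 1) * e * v' t - (p - 1) * a powr p * exp (- (\<kappa> * t)))
        has_integral (F T - F 0)) {0..T}"
      using T dF
      by (intro fundamental_theorem_of_calculus)
        (auto simp: has_real_derivative_iff_has_vector_derivative[symmetric]
          intro: DERIV_subset has_field_derivative_at_within)
    moreover have I: "(h has_integral integral {0..T} h) {0..T}"
      using conth by (intro integrable_integral integrable_continuous_real)
    ultimately have "F T - F 0 \<le> integral {0..T} h"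
      using le by (rule has_integral_le)
    then have "ennreal (F T - F 0) \<le> ennreal (integral {0..T} h)"
      by (rule ennreal_leI)
    also have "\<dots> = (\<integral>\<^sup>+t. ennreal (h t) * indicator {0..T} t \<partial>lborel)"
      using nn_integral_has_integral_lebesgue'[OF h0 I] by simp
    also have "\<dots> \<le> ?I"
      unfolding h_def by (intro nn_integral_mono) (auto simp: indicator_def)
    finally show ?thesis .
  qed
  have limF: "((\<lambda>T. F T - F 0) \<longlongrightarrow> (p * a powr (p - 1) * e * L + (p - 1) * a powr p * 0 / \<kappa>) - F 0) at_top"
  proof -
    have "((\<lambda>t. exp (- (\<kappa> * t))) \<longlongrightarrow> 0) at_top" using \<kappa> by real_asymp
    then show ?thesis
      unfolding F_def using \<kappa> by (intro tendsto_intros lim) auto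
  qed
  have "ennreal ((p * a powr (p - 1) * e * L + (p - 1) * a powr p * 0 / \<kappa>) - F 0) \<le> ?I"
    by (rule tendsto_upperbound[OF tendsto_ennrealI[OF limF]])
      (use fin in \<open>auto intro: eventually_at_top_linorderI[of 0]\<close>)
  also have "(p * a powr (p - 1) * e * L + (p - 1) * a powr p * 0 / \<kappa>) - F 0
      = p * a powr (p - 1) * d - (p - 1) * a powr p / \<kappa>"
    by (auto simp: F_def e_def d_def algebra_simps)
  also have "\<dots> = \<kappa> powr (p - 1) * d powr p"
  proof (cases "d = 0")
    case False
    then have d: "d > 0" by (simp add: d_def)
    have 1: "a powr (p - 1) * d = \<kappa> powr (p - 1) * d powr p"
      using \<kappa> d by (simp add: a_def powr_mult powr_diff)
    have 2: "a powr p / \<kappa> = \<kappa> powr (p - 1) * d powr p"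
      using \<kappa> d by (simp add: a_def powr_mult powr_diff)
    have "p * a powr (p - 1) * d - (p - 1) * a powr p / \<kappa>
        = p * (a powr (p - 1) * d) - (p - 1) * (a powr p / \<kappa>)" by simp
    then show ?thesis
      unfolding 1 2 by (simp add: algebra_simps)
  qed (simp add: a_def)
  finally show ?thesis by (simp add: d_def)
qed

section \<open>Change of variables and the Hardy inequality along dilations\<close>

lemma nn_integral_diagonal_scaling:
  fixes f :: "real^'n::finite \<Rightarrow> ennreal"
  assumes f: "f \<in> borel_measurable borel" and c: "\<And>a. c a > 0"
  shows "(\<integral>\<^sup>+x. f x \<partial>lborel) = ennreal (\<Prod>a\<in>UNIV. c a) * (\<integral>\<^sup>+x. f (\<chi> a. c a * x $ a) \<partial>lborel)"
proof -
  \<comment> \<open>The affine change of variables is indexed by basis vectors; \<open>d\<close>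
    transports the factors \<open>c\<close> from coordinates to them.\<close>
  define d where "d j = c (THE a. j = axis a 1)" for j :: "real^'n"
  have d: "d (axis a 1) = c a" for a
    unfolding d_def by (simp add: axis_eq_axis)
  define T where "T x = 0 + (\<Sum>j\<in>Basis. (d j * (x \<bullet> j)) *\<^sub>R j)" for x :: "real^'n"
  have B: "Basis = range (\<lambda>a. axis a (1::real) :: real^'n)"
    by (auto simp: Basis_vec_def)
  have inj: "inj (\<lambda>a. axis a (1::real) :: real^'n)"
    by (auto simp: inj_def axis_eq_axis)
  have T: "T x = (\<chi> a. c a * x $ a)" for x
    unfolding T_def B
    by (subst sum.reindex[OF inj])
      (simp add: d inner_axis vec_eq_iff sum_component, simp add: axis_def if_distrib cong: if_cong)
  have prod: "(\<Prod>j\<in>Basis. \<bar>d j\<bar>) = (\<Prod>a\<in>UNIV. c a)"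
    unfolding B by (subst prod.reindex[OF inj]) (use c in \<open>auto simp: d less_imp_le\<close>)
  have [measurable]: "T \<in> borel \<rightarrow>\<^sub>M borel"
    unfolding T_def[abs_def] by simp
  note [measurable] = f
  have "lborel = density (distr lborel borel T) (\<lambda>_. ennreal (\<Prod>j\<in>Basis. \<bar>d j\<bar>))"
    unfolding T_def[abs_def]
    by (rule lborel_affine_euclidean) (use c in \<open>auto simp: B d less_imp_neq[symmetric]\<close>)
  then have "(\<integral>\<^sup>+x. f x \<partial>lborel)
      = (\<integral>\<^sup>+x. f x \<partial>density (distr lborel borel T) (\<lambda>_. ennreal (\<Prod>j\<in>Basis. \<bar>d j\<bar>)))"
    by (rule arg_cong)
  also have "\<dots> = ennreal (\<Prod>a\<in>UNIV. c a) * (\<integral>\<^sup>+x. f (T x) \<partial>lborel)"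
    by (simp add: nn_integral_density nn_integral_distr nn_integral_cmult prod)
  finally show ?thesis by (simp add: T)
qed

context block_splitting
begin

text \<open>The constant \<open>C\<close> of the overview: the degree under \<open>dil\<close> of
  the measure with density \<open>hweight s \<mu>\<close>.\<close>

definition hconst :: "real \<Rightarrow> (nat \<Rightarrow> real) \<Rightarrow> real" where
  "hconst s \<mu> = hom_dim k \<alpha> b - s + (\<Sum>i=1..k. \<sigma> i * \<mu> i)"

lemma sum_sigma_b: "(\<Sum>a\<in>UNIV. \<sigma> (b a)) = hom_dim k \<alpha> b"
proof -
  have "(\<Sum>a\<in>UNIV. \<sigma> (b a)) = (\<Sum>i\<in>b ` UNIV. \<Sum>a\<in>{a\<in>UNIV. b a = i}. \<sigma> (b a))"
    by (rule sum.image_gen) simp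
  also have "\<dots> = (\<Sum>i\<in>{1..k}. \<sigma> i * real (block_dim b i))"
    unfolding range_b by (intro sum.cong refl) (simp add: block_dim_def mult.commute)
  finally show ?thesis
    unfolding hom_dim_def .
qed

lemma measurable_dil [measurable]: "(\<lambda>(t, x). dil t x) \<in> borel_measurable (borel \<Otimes>\<^sub>M borel)"
proof -
  have [measurable]: "(\<lambda>x::real^'n. x $ a) \<in> borel_measurable borel" for a
    by (intro borel_measurable_continuous_onI continuous_intros)
  show ?thesis
    unfolding dil_def split_def by (intro measurable_vec_lambda) measurable
qed

lemma measurable_dil_const: "dil t \<in> borel_measurable borel"
  unfolding dil_def by (intro measurable_vec_lambda) measurable

text \<open>The Jacobian of \<open>dil t\<close> contributes the degree
  \<open>hom_dim k \<alpha> b\<close>, and \<open>hweight_dil\<close> the rest of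
  \<open>hconst s \<mu>\<close>. The sign is negative because these factors are moved to the other
  side.\<close>

lemma nn_integral_hweight_dil:
  assumes [measurable]: "f \<in> borel_measurable borel"
  shows "(\<integral>\<^sup>+x. ennreal (hweight s \<mu> x) * f (dil t x) \<partial>lborel)
    = ennreal (exp (- (hconst s \<mu> * t))) * (\<integral>\<^sup>+x. ennreal (hweight s \<mu> x) * f x \<partial>lborel)"
proof -
  let ?S = "(\<Sum>i=1..k. \<sigma> i * \<mu> i) - s"
  note [measurable] = measurable_dil_const
  have "(\<integral>\<^sup>+x. ennreal (hweight s \<mu> x) * f x \<partial>lborel)
      = ennreal (\<Prod>a\<in>UNIV. exp (t * \<sigma> (b a))) *
        (\<integral>\<^sup>+x. ennreal (hweight s \<mu> (dil t x)) * f (dil t x) \<partial>lborel)"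
    unfolding dil_def by (rule nn_integral_diagonal_scaling) auto
  also have "(\<Prod>a\<in>UNIV. exp (t * \<sigma> (b a))) = exp (t * hom_dim k \<alpha> b)"
    by (simp add: exp_sum sum_distrib_left flip: sum_sigma_b)
  also have "(\<integral>\<^sup>+x. ennreal (hweight s \<mu> (dil t x)) * f (dil t x) \<partial>lborel)
      = (\<integral>\<^sup>+x. ennreal (exp (t * ?S)) * (ennreal (hweight s \<mu> x) * f (dil t x)) \<partial>lborel)"
    by (simp add: hweight_dil ennreal_mult' mult.assoc)
  also have "\<dots> = ennreal (exp (t * ?S)) * (\<integral>\<^sup>+x. ennreal (hweight s \<mu> x) * f (dil t x) \<partial>lborel)"
    by (rule nn_integral_cmult) measurable
  finally have eq: "(\<integral>\<^sup>+x. ennreal (hweight s \<mu> x) * f x \<partial>lborel) =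
     (ennreal (exp (t * hom_dim k \<alpha> b)) * ennreal (exp (t * ?S))) *
       (\<integral>\<^sup>+x. ennreal (hweight s \<mu> x) * f (dil t x) \<partial>lborel)"
    by (simp add: mult.assoc)
  have 1: "ennreal (exp (t * hom_dim k \<alpha> b)) * ennreal (exp (t * ?S)) = ennreal (exp (hconst s \<mu> * t))"
    by (simp add: hconst_def algebra_simps flip: ennreal_mult' exp_add)
  have 2: "ennreal (exp (- (hconst s \<mu> * t))) * ennreal (exp (hconst s \<mu> * t)) = 1"
    by (simp flip: ennreal_mult' exp_add)
  show ?thesis
    unfolding eq 1 by (simp add: 2 flip: mult.assoc)
qed

lemma continuous_dil: "continuous_on UNIV (\<lambda>t. dil (\<epsilon> * t) x)"
  unfolding dil_def by (intro continuous_on_vec_lambda continuous_intros)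

text \<open>Orbits are followed outwards for \<open>\<epsilon> = 1\<close> and inwards for
  \<open>\<epsilon> = -1\<close>; either way \<kappa> is the absolute value of
  \<open>hconst s \<mu> / p\<close>. After Tonelli the growth
  \<open>exp (\<kappa> * (p - 1) * t)\<close> from the half line meets the decay
  \<open>exp (- (\<kappa> * p * t))\<close> from the dilation, and the integral of the remaining
  \<open>exp (- (\<kappa> * t))\<close> is \<open>1 / \<kappa>\<close>.\<close>

lemma hardy_dilation:
  fixes \<phi> g :: "real^'n \<Rightarrow> real"
  assumes p: "p > 1" and \<kappa>: "\<kappa> > 0" and \<epsilon>: "\<bar>\<epsilon>\<bar> = 1" and C: "hconst s \<mu> * \<epsilon> = \<kappa> * p"
    and \<phi>: "continuous_on UNIV \<phi>"
    and g: "continuous_on UNIV g"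
    and der: "\<And>t x. ((\<lambda>t. \<phi> (dil t x)) has_real_derivative g (dil t x)) (at t)"
    and lim: "AE x in lborel. ((\<lambda>t. \<phi> (dil (\<epsilon> * t) x)) \<longlongrightarrow> L) at_top"
  shows "ennreal (\<kappa> powr p) * (\<integral>\<^sup>+x. ennreal (hweight s \<mu> x * \<bar>\<phi> x - L\<bar> powr p) \<partial>lborel)
      \<le> (\<integral>\<^sup>+x. ennreal (hweight s \<mu> x * \<bar>g x\<bar> powr p) \<partial>lborel)"
proof -
  have [measurable]: "\<phi> \<in> borel_measurable borel" "g \<in> borel_measurable borel"
    using \<phi> g by (auto intro: borel_measurable_continuous_onI)
  let ?w = "hweight s \<mu>"
  let ?J = "\<integral>\<^sup>+x. ennreal (?w x) * ennreal (\<bar>g x\<bar> powr p) \<partial>lborel"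
  have pt: "ennreal (\<kappa> powr (p - 1)) * ennreal (?w x * \<bar>\<phi> x - L\<bar> powr p) \<le>
     (\<integral>\<^sup>+t. ennreal (exp (\<kappa> * (p - 1) * t)) * indicator {0..} t *
        (ennreal (?w x) * ennreal (\<bar>g (dil (\<epsilon> * t) x)\<bar> powr p)) \<partial>lborel)" (is "?l \<le> ?r")
    if lim: "((\<lambda>t. \<phi> (dil (\<epsilon> * t) x)) \<longlongrightarrow> L) at_top" for x
  proof -
    have "ennreal (\<kappa> powr (p - 1) * \<bar>\<phi> (dil (\<epsilon> * 0) x) - L\<bar> powr p) \<le>
       (\<integral>\<^sup>+t. ennreal (exp (\<kappa> * (p - 1) * t) * \<bar>g (dil (\<epsilon> * t) x) * \<epsilon>\<bar> powr p) * indicator {0..} t \<partial>lborel)"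
    proof (rule hardy_half_line[OF p \<kappa> _ _ lim])
      show "((\<lambda>t. \<phi> (dil (\<epsilon> * t) x)) has_real_derivative g (dil (\<epsilon> * t) x) * \<epsilon>) (at t)" for t
        by (rule DERIV_chain'[where f = "\<lambda>t. \<epsilon> * t"]) (auto intro!: derivative_eq_intros der)
      show "continuous_on UNIV (\<lambda>t. g (dil (\<epsilon> * t) x) * \<epsilon>)"
        by (intro continuous_intros continuous_on_compose2[OF g continuous_dil]) auto
    qed
    moreover have "dil 0 x = x" by (simp add: dil_def)
    ultimately have "ennreal (?w x) * ennreal (\<kappa> powr (p - 1) * \<bar>\<phi> x - L\<bar> powr p) \<le>
       ennreal (?w x) *
       (\<integral>\<^sup>+t. ennreal (exp (\<kappa> * (p - 1) * t) * \<bar>g (dil (\<epsilon> * t) x)\<bar> powr p) * indicator {0..} t \<partial>lborel)"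
      using \<epsilon> by (intro mult_left_mono) (auto simp: abs_mult)
    also have "\<dots> = ?r"
      by (subst nn_integral_cmult[symmetric])
         (measurable, auto intro!: nn_integral_cong simp: ennreal_mult mult_ac)
    finally show ?thesis
      by (simp add: hweight_nonneg ennreal_mult mult_ac)
  qed
  have "ennreal (\<kappa> powr (p - 1)) * (\<integral>\<^sup>+x. ennreal (?w x * \<bar>\<phi> x - L\<bar> powr p) \<partial>lborel)
     = (\<integral>\<^sup>+x. ennreal (\<kappa> powr (p - 1)) * ennreal (?w x * \<bar>\<phi> x - L\<bar> powr p) \<partial>lborel)"
    by (subst nn_integral_cmult) auto
  also have "\<dots> \<le> (\<integral>\<^sup>+x. \<integral>\<^sup>+t. ennreal (exp (\<kappa> * (p - 1) * t)) * indicator {0..} t *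
        (ennreal (?w x) * ennreal (\<bar>g (dil (\<epsilon> * t) x)\<bar> powr p)) \<partial>lborel \<partial>lborel)"
    using lim by (intro nn_integral_mono_AE) (auto elim!: eventually_mono intro: pt)
  also have "\<dots> = (\<integral>\<^sup>+t. \<integral>\<^sup>+x. ennreal (exp (\<kappa> * (p - 1) * t)) * indicator {0..} t *
        (ennreal (?w x) * ennreal (\<bar>g (dil (\<epsilon> * t) x)\<bar> powr p)) \<partial>lborel \<partial>lborel)"
    by (rule lborel_pair.Fubini'[symmetric]) measurable
  also have "\<dots> = (\<integral>\<^sup>+t. ennreal (exp (- (\<kappa> * t))) * indicator {0..} t * ?J \<partial>lborel)"
  proof (intro nn_integral_cong)
    fix t :: real
    note [measurable] = measurable_dil_const
    have e: "exp (\<kappa> * (p - 1) * t) * exp (- (hconst s \<mu> * (\<epsilon> * t))) = exp (- (\<kappa> * t))"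
    proof -
      have "\<kappa> * (p - 1) * t + - (hconst s \<mu> * \<epsilon>) * t = - (\<kappa> * t)"
        unfolding C by (simp add: algebra_simps)
      then show ?thesis by (simp add: mult.assoc flip: exp_add)
    qed
    have "(\<integral>\<^sup>+x. ennreal (exp (\<kappa> * (p - 1) * t)) * indicator {0..} t *
        (ennreal (?w x) * ennreal (\<bar>g (dil (\<epsilon> * t) x)\<bar> powr p)) \<partial>lborel)
       = ennreal (exp (\<kappa> * (p - 1) * t)) * indicator {0..} t *
         (\<integral>\<^sup>+x. ennreal (?w x) * ennreal (\<bar>g (dil (\<epsilon> * t) x)\<bar> powr p) \<partial>lborel)"
      by (rule nn_integral_cmult) measurable
    also have "\<dots> = ennreal (exp (\<kappa> * (p - 1) * t)) * indicator {0..} t *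
         (ennreal (exp (- (hconst s \<mu> * (\<epsilon> * t)))) * ?J)"
      by (subst nn_integral_hweight_dil[where f = "\<lambda>y. ennreal (\<bar>g y\<bar> powr p)"]) auto
    also have "\<dots> = (ennreal (exp (\<kappa> * (p - 1) * t)) * ennreal (exp (- (hconst s \<mu> * (\<epsilon> * t))))) * 
        indicator {0..} t * ?J"
      by (simp only: mult_ac)
    also have "ennreal (exp (\<kappa> * (p - 1) * t)) * ennreal (exp (- (hconst s \<mu> * (\<epsilon> * t))))
        = ennreal (exp (- (\<kappa> * t)))"
      by (simp add: e flip: ennreal_mult')
    finally show "(\<integral>\<^sup>+x. ennreal (exp (\<kappa> * (p - 1) * t)) * indicator {0..} t *
        (ennreal (?w x) * ennreal (\<bar>g (dil (\<epsilon> * t) x)\<bar> powr p)) \<partial>lborel)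
       = ennreal (exp (- (\<kappa> * t))) * indicator {0..} t * ?J" .
  qed
  also have "\<dots> = ennreal (1 / \<kappa>) * ?J"
    by (subst nn_integral_multc) (auto simp: nn_integral_exp_neg[OF \<kappa>])
  finally have "ennreal \<kappa> * (ennreal (\<kappa> powr (p - 1)) * (\<integral>\<^sup>+x. ennreal (?w x * \<bar>\<phi> x - L\<bar> powr p) \<partial>lborel))
      \<le> ennreal \<kappa> * (ennreal (1 / \<kappa>) * ?J)"
    by (rule mult_left_mono) simp
  moreover have "ennreal \<kappa> * ennreal (\<kappa> powr (p - 1)) = ennreal (\<kappa> powr p)"
    using \<kappa> by (simp add: powr_diff flip: ennreal_mult')
  moreover have "ennreal \<kappa> * ennreal (1 / \<kappa>) = 1"
    using \<kappa> by (simp flip: ennreal_mult')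
  ultimately show ?thesis
    by (simp add: hweight_nonneg ennreal_mult flip: mult.assoc)
qed

section \<open>The Euler field and the weight of the gradient\<close>

text \<open>The derivative along the generator of \<open>dil\<close>, written by coordinates; see
  \<open>DERIV_dil\<close>.\<close>

definition euler :: "(real^'n \<Rightarrow> real) \<Rightarrow> real^'n \<Rightarrow> real" where
  "euler \<phi> x = (\<Sum>a\<in>UNIV. \<sigma> (b a) * x $ a * frechet_derivative \<phi> (at x) (axis a 1))"

text \<open>Interchanging the products collects the powers of each block norm; their exponents add
  up because the norms are positive on \<open>gen\<close>.\<close>

lemma prod_lam:
  assumes "x \<in> gen"
  shows "(\<Prod>i=1..k. lam k \<alpha> b i x) = (\<Prod>j=1..k. norm (block b j x) powr colsum j)"
proof -
  have "(\<Prod>i=1..k. lam k \<alpha> b i x) = (\<Prod>j=1..k. \<Prod>i=1..k. norm (block b j x) powr \<alpha> i j)"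
    unfolding lam_def using assms by (subst prod.swap) (auto simp: gen_def rpow_pos intro!: prod.cong)
  also have "\<dots> = (\<Prod>j=1..k. norm (block b j x) powr colsum j)"
    unfolding colsum_def using assms by (intro prod.cong refl) (simp add: gen_def powr_sum)
  finally show ?thesis .
qed

lemma sum_over_blocks: "(\<Sum>a\<in>UNIV. f (b a) * (x $ a)\<^sup>2) = (\<Sum>i=1..k. f i * (norm (block b i x))\<^sup>2)"
proof -
  have "(\<Sum>a\<in>UNIV. f (b a) * (x $ a)\<^sup>2) = (\<Sum>i\<in>b ` UNIV. \<Sum>a\<in>{a\<in>UNIV. b a = i}. f (b a) * (x $ a)\<^sup>2)"
    by (rule sum.image_gen) simp
  also have "\<dots> = (\<Sum>i=1..k. f i * (norm (block b i x))\<^sup>2)"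
    unfolding range_b norm_block_power2 sum_distrib_left by (intro sum.cong) auto
  finally show ?thesis .
qed

lemma hom_norm_powr_M: "x \<in> gen \<Longrightarrow> hom_norm k \<alpha> b x powr M = sqrt (hom_sum x)"
  using M_ge_1 hom_sum_nonneg[of x] by (simp add: hom_norm_eq powr_powr powr_half_sqrt)

text \<open>Cauchy-Schwarz; the vector multiplying \<open>grad_lam\<close> has norm \<open>[[x]] powr M / \<Prod> \<lambda>\<^sub>i\<close>
  precisely because of the shape of the homogeneous norm.\<close>

lemma abs_euler_le:
  assumes x: "x \<in> gen"
  shows "\<bar>euler \<phi> x\<bar> \<le>
    hom_norm k \<alpha> b x powr M / (\<Prod>i=1..k. lam k \<alpha> b i x) * norm (grad_lam k \<alpha> b \<phi> x)"
proof -
  let ?l = "\<lambda>i. lam k \<alpha> b i x" and ?P = "\<Prod>i=1..k. lam k \<alpha> b i x"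
  have lpos: "?l i > 0" for i using lam_pos[OF x] .
  define z :: "real^'n" where "z = (\<chi> a. \<sigma> (b a) * x $ a / ?l (b a))"
  have "euler \<phi> x = z \<bullet> grad_lam k \<alpha> b \<phi> x"
    unfolding euler_def z_def grad_lam_def inner_vec_def
    using lpos by (intro sum.cong) (auto simp: less_imp_neq[symmetric])
  then have "\<bar>euler \<phi> x\<bar> \<le> norm z * norm (grad_lam k \<alpha> b \<phi> x)"
    by (simp add: Cauchy_Schwarz_ineq2)
  also have "norm z = sqrt (\<Sum>a\<in>UNIV. (\<sigma> (b a) / ?l (b a))\<^sup>2 * (x $ a)\<^sup>2)"
    by (simp add: norm_vec_def L2_set_def z_def power_mult_distrib power_divide)
  also have "(\<Sum>a\<in>UNIV. (\<sigma> (b a) / ?l (b a))\<^sup>2 * (x $ a)\<^sup>2)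
      = (\<Sum>i=1..k. (\<sigma> i / ?l i)\<^sup>2 * (norm (block b i x))\<^sup>2)"
    by (rule sum_over_blocks)
  also have "\<dots> = hom_sum x / ?P\<^sup>2"
    unfolding hom_sum_def sum_divide_distrib
  proof (intro sum.cong refl)
    fix j assume j: "j \<in> {1..k}"
    have "?P = ?l j * (\<Prod>i\<in>{1..k} - {j}. ?l i)"
      using j by (simp add: prod.remove)
    moreover have "(\<Prod>i\<in>{1..k} - {j}. ?l i) \<noteq> 0"
      using lpos by (simp add: less_imp_neq[symmetric])
    ultimately show "(\<sigma> j / ?l j)\<^sup>2 * (norm (block b j x))\<^sup>2 =
        (\<Prod>i\<in>{1..k} - {j}. (?l i)\<^sup>2) * (\<sigma> j)\<^sup>2 * (norm (block b j x))\<^sup>2 / ?P\<^sup>2"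
      using lpos[of j] by (simp del: prod_zero_iff add: power_mult_distrib power_divide flip: prod_power_distrib)
  qed
  also have "sqrt (hom_sum x / ?P\<^sup>2) = hom_norm k \<alpha> b x powr M / ?P"
    using prod_nonneg[of "{1..k}" ?l] lam_nonneg
    by (simp add: real_sqrt_divide hom_norm_powr_M[OF x])
  finally show ?thesis .
qed

text \<open>The last factor is the \<open>p\<close>-th power of the one in
  \<open>abs_euler_le\<close>. By \<open>prod_lam\<close> the identity is a comparison of the
  exponents of \<open>hom_norm\<close> and of each block norm.\<close>

lemma hardy_weight_eq:
  assumes x: "x \<in> gen"
  shows "hardy_weight k \<alpha> b p s \<mu> x =
    hweight s \<mu> x * (hom_norm k \<alpha> b x powr M / (\<Prod>i=1..k. lam k \<alpha> b i x)) powr p"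
proof -
  let ?h = "hom_norm k \<alpha> b x" and ?n = "\<lambda>i. norm (block b i x)"
  have h: "?h > 0" using hom_norm_pos[OF x] .
  have n: "?n i > 0" if "i \<in> {1..k}" for i using x that by (simp add: gen_def)
  have "(?h powr M / (\<Prod>i=1..k. lam k \<alpha> b i x)) powr p
      = ?h powr (M * p) / (\<Prod>i=1..k. ?n i powr (p * colsum i))"
    unfolding prod_lam[OF x]
    by (simp add: powr_divide powr_powr mult.commute prod_powr_distrib)
  moreover have "hardy_weight k \<alpha> b p s \<mu> x =
      ?h powr (p * M - s) / (\<Prod>i=1..k. ?n i powr (p * colsum i - \<mu> i))"
    unfolding hardy_weight_def M_def[symmetric] colsum_def[symmetric]
    using h n by (auto simp: rpow_pos intro!: prod.cong)
  moreover have "(\<Prod>i=1..k. ?n i powr (p * colsum i - \<mu> i))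
      = (\<Prod>i=1..k. ?n i powr (p * colsum i)) / (\<Prod>i=1..k. ?n i powr \<mu> i)"
    by (simp add: powr_diff prod_dividef)
  moreover have "hweight s \<mu> x = (\<Prod>i=1..k. ?n i powr \<mu> i) / ?h powr s"
    unfolding hweight_def using h n by (auto simp: rpow_pos intro!: prod.cong)
  ultimately show ?thesis
    by (simp add: powr_diff mult.commute[of p M])
qed

lemma hweight_euler_le:
  assumes x: "x \<in> gen" and p: "p > 1"
  shows "hweight s \<mu> x * \<bar>euler \<phi> x\<bar> powr p \<le>
    hardy_weight k \<alpha> b p s \<mu> x * norm (grad_lam k \<alpha> b \<phi> x) powr p"
proof -
  have "hweight s \<mu> x * \<bar>euler \<phi> x\<bar> powr p \<le> hweight s \<mu> x *
      (hom_norm k \<alpha> b x powr M / (\<Prod>i=1..k. lam k \<alpha> b i x) * norm (grad_lam k \<alpha> b \<phi> x)) powr p"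
    using abs_euler_le[OF x] p by (intro mult_left_mono powr_mono2 hweight_nonneg) auto
  then show ?thesis
    unfolding hardy_weight_eq[OF x] powr_mult by (simp only: mult.assoc)
qed

section \<open>Test functions along the orbits\<close>

lemma C01_continuous: "\<phi> \<in> C01 \<Omega> \<Longrightarrow> continuous_on A \<phi>"
  unfolding C01_def
  by (auto intro!: continuous_at_imp_continuous_on differentiable_imp_continuous_within)

lemma continuous_euler: "\<phi> \<in> C01 \<Omega> \<Longrightarrow> continuous_on UNIV (euler \<phi>)"
  unfolding C01_def euler_def[abs_def] by (auto intro!: continuous_intros)

lemma DERIV_dil:
  assumes "\<phi> \<in> C01 \<Omega>"
  shows "((\<lambda>t. \<phi> (dil t x)) has_real_derivative euler \<phi> (dil t x)) (at t)"
proof -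
  have lin: "linear (frechet_derivative \<phi> (at y))"
    and der: "(\<phi> has_derivative frechet_derivative \<phi> (at y)) (at y)" for y
    using assms by (auto simp: C01_def linear_frechet_derivative frechet_derivative_works)
  have eq: "dil t x = (\<Sum>a\<in>UNIV. (exp (t * \<sigma> (b a)) * x $ a) *\<^sub>R axis a 1)" for t
    by (simp add: vec_eq_iff dil_def sum_component axis_def if_distrib cong: if_cong)
  let ?v = "\<Sum>a\<in>UNIV. (\<sigma> (b a) * dil t x $ a) *\<^sub>R axis a (1::real) :: real^'n"
  have "((\<lambda>t. dil t x) has_vector_derivative ?v) (at t)"
    unfolding eq
    by (intro has_vector_derivative_sum)
      (auto intro!: derivative_eq_intros simp: sum_component axis_def if_distrib cong: if_cong)
  then have "((\<lambda>t. \<phi> (dil t x)) has_derivative (\<lambda>h. frechet_derivative \<phi> (at (dil t x)) (h *\<^sub>R ?v))) (at t)"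
    unfolding has_vector_derivative_def
    using diff_chain_at[OF _ der, of "\<lambda>t. dil t x"] by (auto simp: o_def)
  moreover have "frechet_derivative \<phi> (at (dil t x)) (h *\<^sub>R ?v) = euler \<phi> (dil t x) * h" for h
    by (simp add: linear_scale[OF lin] linear_sum[OF lin] euler_def)
  ultimately show ?thesis
    by (simp add: has_field_derivative_def)
qed

lemma sigma_b_ge_1: "\<sigma> (b a) \<ge> 1"
  using sigma_ge_1[OF b_mem] .

lemma C01_bounded_support:
  assumes "\<phi> \<in> C01 \<Omega>"
  obtains R where "R > 0" "\<And>x. norm x > R \<Longrightarrow> \<phi> x = 0"
proof -
  have "bounded {x. \<phi> x \<noteq> 0}"
    using assms by (auto simp: C01_def dest!: compact_imp_bounded intro: bounded_subset closure_subset)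
  then show ?thesis
    using that unfolding bounded_pos by (metis (mono_tags) mem_Collect_eq not_less)
qed

text \<open>A nonzero coordinate of \<open>x\<close> grows at least like \<open>exp t\<close>,
  because all \<open>\<sigma> i \<ge> 1\<close>; hence the orbit leaves the bounded support.\<close>

lemma tendsto_dil_at_top:
  assumes \<phi>: "\<phi> \<in> C01 \<Omega>" and x: "x \<noteq> 0"
  shows "((\<lambda>t. \<phi> (dil t x)) \<longlongrightarrow> 0) at_top"
proof -
  obtain R where R: "R > 0" "\<And>x. norm x > R \<Longrightarrow> \<phi> x = 0"
    using C01_bounded_support[OF \<phi>] by blast
  obtain a where a: "x $ a \<noteq> 0" using x by (auto simp: vec_eq_iff)
  define c where "c = \<bar>x $ a\<bar>"
  have c: "c > 0" using a by (simp add: c_def)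
  have "filterlim (\<lambda>t. exp t * c) at_top at_top" using c by real_asymp
  then have "eventually (\<lambda>t. exp t * c > R) at_top"
    by (auto simp: filterlim_at_top_dense)
  then have "eventually (\<lambda>t. \<phi> (dil t x) = 0) at_top"
    using eventually_ge_at_top[of 0]
  proof eventually_elim
    case (elim t)
    have "t * 1 \<le> t * \<sigma> (b a)"
      using elim sigma_b_ge_1 by (intro mult_left_mono) auto
    then have "exp t * c \<le> exp (t * \<sigma> (b a)) * c"
      using c by (intro mult_right_mono) auto
    also have "\<dots> = \<bar>dil t x $ a\<bar>"
      by (simp add: dil_def c_def abs_mult)
    also have "\<dots> \<le> norm (dil t x)" by (rule component_le_norm_cart)
    finally show ?case using elim by (intro R) auto
  qed
  then show ?thesis by (rule tendsto_eventually)
qed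

text \<open>All weights \<sigma> are positive, so every orbit runs backwards into the origin, where
  \<phi> is continuous.\<close>

lemma tendsto_dil_at_bot:
  assumes \<phi>: "\<phi> \<in> C01 \<Omega>"
  shows "((\<lambda>t. \<phi> (dil (- t) x)) \<longlongrightarrow> \<phi> 0) at_top"
proof -
  have "((\<lambda>t. dil (- t) x) \<longlongrightarrow> 0) at_top"
  proof (rule vec_tendstoI)
    fix a
    have "((\<lambda>t. exp (- t * c)) \<longlongrightarrow> 0) at_top" if "c > 0" for c :: real
      using that by real_asymp
    moreover have "\<sigma> (b a) > 0" using sigma_b_ge_1[of a] by simp
    ultimately have "((\<lambda>t. exp (- t * \<sigma> (b a)) * x $ a) \<longlongrightarrow> 0) at_top"
      by (intro tendsto_mult_left_zero)
    then show "((\<lambda>t. dil (- t) x $ a) \<longlongrightarrow> 0 $ a) at_top"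
      by (simp add: dil_def)
  qed
  moreover have "isCont \<phi> 0"
    using C01_continuous[OF \<phi>, of UNIV] by (simp add: continuous_on_eq_continuous_at)
  ultimately show ?thesis
    by (rule isCont_tendsto_compose[rotated])
qed

end

section \<open>Divergence of the weight when the constant is negative\<close>

text \<open>One lower bound for both signs of the exponent, for use with the exponents
  \<open>\<mu> j\<close>.\<close>

lemma powr_ge_powr_neg_abs:
  fixes t B e :: real
  assumes "1 \<le> t" "t \<le> B"
  shows "B powr (- \<bar>e\<bar>) \<le> t powr e"
proof -
  have "B powr (- \<bar>e\<bar>) \<le> t powr (- \<bar>e\<bar>)"
    using assms by (intro powr_mono2') auto
  also have "\<dots> \<le> t powr e"
    using assms by (intro powr_mono) auto
  finally show ?thesis .
qed

context block_splitting
begin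

text \<open>The minimum includes the entry \<open>\<alpha> i i = 0\<close>, so it is at most
  \<open>0\<close> and \<open>- p\<close> times it is nonnegative.\<close>

lemma hardy_params_less:
  assumes "hardy_params k \<alpha> b p s \<mu>" "p > 1" "i \<in> {1..k}"
  shows "s < real (block_dim b i) + \<mu> i"
proof -
  have "Min (insert 1 ((\<lambda>j. \<alpha> j i) ` {1..k})) \<le> \<alpha> i i"
    using assms by (intro Min_le) auto
  then have "p * Min (insert 1 ((\<lambda>j. \<alpha> j i) ` {1..k})) \<le> 0"
    using assms alpha_upper[of i i] by (simp add: mult_le_0_iff)
  then show ?thesis
    using assms(1,3) unfolding hardy_params_def by fastforce
qed

lemma hconst_eq: "hconst s \<mu> = (\<Sum>i=1..k. \<sigma> i * (real (block_dim b i) + \<mu> i)) - s"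
  by (simp add: hconst_def hom_dim_def algebra_simps sum.distrib)

text \<open>For the block found here \<open>\<mu> i - s * colsum i / M\<close> is at most
  \<open>- block_dim b i\<close>, the threshold for a non-integrable singularity where block
  \<open>i\<close> vanishes. It exists by averaging: the opposite strict inequalities for all
  \<open>i\<close>, summed with weights \<open>\<sigma> i\<close>, would give
  \<open>hconst s \<mu> > - s / M > 0\<close>.\<close>

lemma hconst_neg_exponent:
  assumes par: "\<And>i. i \<in> {1..k} \<Longrightarrow> s < real (block_dim b i) + \<mu> i" and neg: "hconst s \<mu> < 0"
  obtains i where "i \<in> {1..k}" "real (block_dim b i) + \<mu> i \<le> s * colsum i / M"
    and "s < 0" "1 < k"
proof -
  have sp: "\<sigma> i > 0" if "i \<in> {1..k}" for i using sigma_ge_1[OF that] by simp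
  have ne: "{1..k} \<noteq> {}" using one_le_k by simp
  \<comment> \<open>Replacing every \<open>block_dim b i + \<mu> i\<close> by its lower bound
    \<open>s\<close> bounds \<open>hconst s \<mu>\<close> from below. Its negativity then forces
    \<open>s < 0\<close>, and excludes \<open>k = 1\<close>, where the bound is
    \<open>0\<close>.\<close>
  have "s * ((\<Sum>i=1..k. \<sigma> i) - 1) = (\<Sum>i=1..k. \<sigma> i * s) - s"
    by (simp add: right_diff_distrib mult.commute flip: sum_distrib_left)
  also have "\<dots> < hconst s \<mu>"
    unfolding hconst_eq
    by (intro diff_strict_right_mono sum_strict_mono mult_strict_left_mono par sp ne) auto
  finally have lt: "s * ((\<Sum>i=1..k. \<sigma> i) - 1) < hconst s \<mu>" .
  have S: "(\<Sum>i=1..k. \<sigma> i) \<ge> real k"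
    using sum_bounded_below[of "{1..k}" 1 \<sigma>] sigma_ge_1 by simp
  have s: "s < 0"
  proof (rule ccontr)
    assume "\<not> s < 0"
    then have "0 \<le> s * ((\<Sum>i=1..k. \<sigma> i) - 1)" using S one_le_k by simp
    with lt neg show False by simp
  qed
  have k: "1 < k"
  proof (rule ccontr)
    assume "\<not> 1 < k"
    then have "k = 1" using one_le_k by simp
    moreover have "\<sigma> 1 = 1" by (subst sigma.simps) simp
    ultimately show False using lt neg by simp
  qed
  have "\<exists>i\<in>{1..k}. real (block_dim b i) + \<mu> i \<le> s * colsum i / M"
  proof (rule ccontr)
    assume *: "\<not> ?thesis"
    have "(\<Sum>i=1..k. \<sigma> i * (s * colsum i / M)) - s < hconst s \<mu>"
      unfolding hconst_eq using *
      by (intro diff_strict_right_mono sum_strict_mono mult_strict_left_mono sp ne) (auto simp: not_le)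
    moreover have "(\<Sum>i=1..k. \<sigma> i * (s * colsum i / M)) = s * (M - 1) / M"
      unfolding M_eq_colsum by (simp add: sum_distrib_left sum_divide_distrib mult_ac)
    ultimately have "s * (M - 1) / M - s < 0" using neg by simp
    moreover have "s * (M - 1) / M - s = - s / M"
      using M_ge_1 by (simp add: field_simps)
    moreover have "- s / M > 0" using s M_ge_1 by (intro divide_pos_pos) auto
    ultimately show False by simp
  qed
  then show ?thesis using that s k by blast
qed

lemma continuous_block: "continuous_on A (block b i)"
  unfolding block_def
proof (intro continuous_on_vec_lambda)
  fix a show "continuous_on A (\<lambda>x. if b a = i then x $ a else 0)"
    by (cases "b a = i") (auto intro!: continuous_intros)
qed

text \<open>Only block \<open>i\<close> can come close to zero: for \<open>R \<ge> 1\<close> the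
  other coordinates keep the norms of their blocks bounded and at least \<open>1\<close>.\<close>

definition slab :: "nat \<Rightarrow> real \<Rightarrow> real \<Rightarrow> real \<Rightarrow> (real^'n) set" where
  "slab i R c d = {x. c < norm (block b i x) \<and> norm (block b i x) < d \<and>
     (\<forall>a. b a \<noteq> i \<longrightarrow> R < x $ a \<and> x $ a < R + 1)}"

lemma open_slab: "open (slab i R c d)"
proof -
  have "open {x::real^'n. b a \<noteq> i \<longrightarrow> R < x $ a \<and> x $ a < R + 1}" for a
    by (cases "b a = i") (auto intro!: open_Collect_conj open_Collect_less continuous_intros)
  then have "open (\<Inter>a. {x::real^'n. b a \<noteq> i \<longrightarrow> R < x $ a \<and> x $ a < R + 1})"
    by (intro open_INT) auto
  moreover have "open {x. c < norm (block b i x) \<and> norm (block b i x) < d}"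
    by (intro open_Collect_conj open_Collect_less continuous_intros continuous_block)
  moreover have "slab i R c d = {x. c < norm (block b i x) \<and> norm (block b i x) < d} \<inter>
      (\<Inter>a. {x. b a \<noteq> i \<longrightarrow> R < x $ a \<and> x $ a < R + 1})"
    by (auto simp: slab_def)
  ultimately show ?thesis by (simp add: open_Int)
qed

lemma slab_nonempty:
  assumes "i \<in> {1..k}" "0 \<le> c" "c < d"
  shows "slab i R c d \<noteq> {}"
proof -
  from b_surj[OF assms(1)] obtain a0 where a0: "b a0 = i" by blast
  define x :: "real^'n" where "x = (\<chi> a. if a = a0 then (c + d) / 2 else if b a = i then 0 else R + 1/2)"
  have "block b i x = ((c + d) / 2) *\<^sub>R axis a0 1"
    using a0 by (auto simp: vec_eq_iff block_def axis_def x_def)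
  then have "norm (block b i x) = (c + d) / 2"
    using assms by simp
  then have "x \<in> slab i R c d"
    using assms a0 by (auto simp: slab_def x_def)
  then show ?thesis by blast
qed

text \<open>The integral over \<open>0 < \<bar>x\<^sub>i\<bar> < 1\<close> is invariant under halving \<open>x\<^sub>i\<close>, so the part
  \<open>1/2 < \<bar>x\<^sub>i\<bar> < 1\<close>, whose integral is positive, would have to vanish if it were finite.\<close>

lemma nn_integral_slab_top:
  assumes i: "i \<in> {1..k}"
  shows "(\<integral>\<^sup>+x. ennreal (norm (block b i x) powr (- real (block_dim b i))) *
     indicator (slab i R 0 1) x \<partial>lborel) = \<infinity>"
proof (rule ccontr)
  let ?h = "\<lambda>x. ennreal (norm (block b i x) powr (- real (block_dim b i)))"
  let ?K = "\<lambda>A. \<integral>\<^sup>+x. ?h x * indicator A x \<partial>lborel"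
  assume "?K (slab i R 0 1) \<noteq> \<infinity>"
  then have fin: "?K (slab i R 0 1) < \<infinity>" by (simp add: less_top)
  have [measurable]: "slab i R c d \<in> sets borel" for c d
    using open_slab by (rule borel_open)
  have meas: "(\<lambda>x. ?h x * indicator (slab i R c d) x) \<in> borel_measurable borel" for c d
    by measurable
  \<comment> \<open>Only block \<open>i\<close> is halved. The Jacobian
    \<open>(1/2) powr block_dim b i\<close> cancels the factor \<open>2 powr block_dim b i\<close>
    that the integrand produces.\<close>
  define c where "c a = (if b a = i then 1/2 else 1::real)" for a
  have c: "c a > 0" for a by (simp add: c_def)
  have bl: "block b i (\<chi> a. c a * x $ a) = (1/2) *\<^sub>R block b i x" for x
    by (auto simp: vec_eq_iff block_def c_def)
  have sl: "(\<chi> a. c a * x $ a) \<in> slab i R 0 (1/2) \<longleftrightarrow> x \<in> slab i R 0 1" for x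
    unfolding slab_def mem_Collect_eq bl by (auto simp: c_def)
  have hh: "?h (\<chi> a. c a * x $ a) = ennreal (2 powr real (block_dim b i)) * ?h x" for x
    unfolding bl by (simp add: powr_mult powr_minus_divide powr_divide flip: ennreal_mult')
  have pc: "(\<Prod>a\<in>UNIV. c a) = (1/2) powr real (block_dim b i)"
    by (simp add: c_def prod.If_cases block_dim_def powr_realpow)
  have "?K (slab i R 0 (1/2)) = ennreal (\<Prod>a\<in>UNIV. c a) *
      (\<integral>\<^sup>+x. ?h (\<chi> a. c a * x $ a) * indicator (slab i R 0 (1/2)) (\<chi> a. c a * x $ a) \<partial>lborel)"
    by (rule nn_integral_diagonal_scaling[OF meas c])
  also have "(\<integral>\<^sup>+x. ?h (\<chi> a. c a * x $ a) * indicator (slab i R 0 (1/2)) (\<chi> a. c a * x $ a) \<partial>lborel)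
      = (\<integral>\<^sup>+x. ennreal (2 powr real (block_dim b i)) * (?h x * indicator (slab i R 0 1) x) \<partial>lborel)"
    unfolding hh by (intro nn_integral_cong) (auto simp: indicator_def sl mult.assoc)
  also have "\<dots> = ennreal (2 powr real (block_dim b i)) * ?K (slab i R 0 1)"
    by (rule nn_integral_cmult) measurable
  also have "ennreal (\<Prod>a\<in>UNIV. c a) * (ennreal (2 powr real (block_dim b i)) * ?K (slab i R 0 1)) = ?K (slab i R 0 1)"
    unfolding pc by (simp add: powr_divide flip: mult.assoc ennreal_mult')
  finally have half: "?K (slab i R 0 (1/2)) = ?K (slab i R 0 1)" .
  have "?K (slab i R 0 (1/2)) + ?K (slab i R (1/2) 1)
      = (\<integral>\<^sup>+x. ?h x * indicator (slab i R 0 (1/2)) x + ?h x * indicator (slab i R (1/2) 1) x \<partial>lborel)"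
    by (rule nn_integral_add[symmetric]) measurable
  also have "\<dots> \<le> ?K (slab i R 0 1)"
    by (intro nn_integral_mono) (auto simp: indicator_def slab_def)
  finally have "?K (slab i R (1/2) 1) = 0"
    unfolding half using fin by (cases "?K (slab i R 0 1)"; cases "?K (slab i R (1/2) 1)")
      (auto simp: top_unique simp flip: ennreal_plus)
  then have "AE x in lborel. ?h x * indicator (slab i R (1/2) 1) x = 0"
    by (subst (asm) nn_integral_0_iff_AE) measurable
  then have "AE x in lborel. x \<notin> slab i R (1/2) 1"
    by eventually_elim (auto simp: slab_def indicator_def split: if_splits)
  then have "emeasure lborel (slab i R (1/2) 1) = 0"
    by (subst (asm) AE_iff_measurable[of "slab i R (1/2) 1"]) auto
  then have "negligible (slab i R (1/2) 1)"
    by (simp add: negligible_iff_null_sets null_sets_completion_iff null_sets_def)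
  then show False
    using open_not_negligible[OF open_slab slab_nonempty[OF i, of "1/2" 1 R]] by simp
qed

text \<open>For \<open>s < 0\<close> the denominator of \<open>hweight\<close> amounts to a positive
  power of \<open>hom_sum\<close>, which is at least its summand for some block \<open>J\<close>
  other than \<open>i\<close>. On the slab all other block norms are at least \<open>1\<close>, so
  each \<open>lam\<close> is at least its factor from block \<open>i\<close>.\<close>

lemma hweight_slab_ge:
  assumes i: "i \<in> {1..k}" and ex: "real (block_dim b i) + \<mu> i \<le> s * colsum i / M"
    and s: "s < 0" and k: "1 < k" and R: "R \<ge> 1"
  obtains c where "c > 0" and "\<And>x. x \<in> slab i R 0 1 \<Longrightarrow>
     c * norm (block b i x) powr (- real (block_dim b i)) \<le> hweight s \<mu> x"
proof -
  \<comment> \<open>An upper bound for the norms of the other blocks on the slab, through the sum of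
    the absolute values of the coordinates.\<close>
  define B where "B = real CARD('n) * (R + 1)"
  define c where "c = (\<Prod>j\<in>{1..k} - {i}. B powr (- \<bar>\<mu> j\<bar>))"
  have B: "B > 0" using R by (simp add: B_def)
  have c: "c > 0" using B by (auto simp: c_def intro!: prod_pos)
  define J where "J = (if i = 1 then 2 else 1 :: nat)"
  have J: "J \<in> {1..k}" "J \<noteq> i" using k by (auto simp: J_def)
  have bound: "c * norm (block b i x) powr (- real (block_dim b i)) \<le> hweight s \<mu> x"
    if x: "x \<in> slab i R 0 1" for x
  proof -
    let ?n = "\<lambda>j. norm (block b j x)"
    have ni: "0 < ?n i" "?n i < 1" using x by (auto simp: slab_def)
    have n1: "1 \<le> ?n j" and nB: "?n j \<le> B" if j: "j \<in> {1..k}" "j \<noteq> i" for j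
    proof -
      from b_surj[OF j(1)] obtain a where a: "b a = j" by blast
      have "R < x $ a" using x a j by (auto simp: slab_def)
      also have "x $ a = block b j x $ a" using a by (simp add: block_def)
      also have "\<dots> \<le> ?n j" using component_le_norm_cart[of "block b j x" a] by linarith
      finally show "1 \<le> ?n j" using R by simp
      have "?n j \<le> (\<Sum>a\<in>UNIV. \<bar>block b j x $ a\<bar>)" by (rule norm_le_l1_cart)
      also have "\<dots> \<le> (\<Sum>a\<in>(UNIV::'n set). R + 1)"
        using x j R by (intro sum_mono) (force simp: block_def slab_def)
      finally show "?n j \<le> B" by (simp add: B_def)
    qed
    have gen: "x \<in> gen"
      unfolding gen_def using ni n1 by (fastforce simp flip: norm_le_zero_iff)
    have n0: "?n j > 0" if "j \<in> {1..k}" for j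
      using gen that by (simp add: gen_def)
    have lam: "?n i powr \<alpha> l i \<le> lam k \<alpha> b l x" if l: "l \<in> {1..k}" for l
    proof -
      have "lam k \<alpha> b l x = ?n i powr \<alpha> l i * (\<Prod>j\<in>{1..k} - {i}. ?n j powr \<alpha> l j)"
        unfolding lam_def using n0 i by (subst prod.remove[of _ i]) (auto simp: rpow_pos)
      moreover have "1 \<le> (\<Prod>j\<in>{1..k} - {i}. ?n j powr \<alpha> l j)"
        using n1 alpha_nonneg l by (intro prod_ge_1) (auto simp: ge_one_powr_ge_zero)
      ultimately show ?thesis
        by (simp add: mult_le_cancel_left1)
    qed
    \<comment> \<open>The base is below \<open>1\<close>, so omitting \<open>\<alpha> J i\<close>
      from the exponent does not decrease the power. What remains is the exponent belonging to the
      product in summand \<open>J\<close>.\<close>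
    have "?n i powr (2 * colsum i) \<le> ?n i powr (2 * (colsum i - \<alpha> J i))"
      using ni alpha_nonneg[OF J(1) i] by (intro powr_mono') auto
    also have "colsum i - \<alpha> J i = (\<Sum>l\<in>{1..k} - {J}. \<alpha> l i)"
      using J by (simp add: colsum_def sum.remove[of _ J])
    also have "?n i powr (2 * (\<Sum>l\<in>{1..k} - {J}. \<alpha> l i)) = (\<Prod>l\<in>{1..k} - {J}. (?n i powr \<alpha> l i)\<^sup>2)"
      using ni by (simp add: sum_distrib_left powr_sum powr_power mult.commute)
    also have "\<dots> \<le> (\<Prod>l\<in>{1..k} - {J}. (lam k \<alpha> b l x)\<^sup>2)"
      by (intro prod_mono conjI power_mono lam) auto
    also have "\<dots> \<le> (\<Prod>l\<in>{1..k} - {J}. (lam k \<alpha> b l x)\<^sup>2) * ((\<sigma> J)\<^sup>2 * (?n J)\<^sup>2)"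
    proof -
      have "1 * 1 \<le> (\<sigma> J)\<^sup>2 * (?n J)\<^sup>2"
        using sigma_ge_1[OF J(1)] n1[OF J] by (intro mult_mono) auto
      moreover have "0 \<le> (\<Prod>l\<in>{1..k} - {J}. (lam k \<alpha> b l x)\<^sup>2)" by (intro prod_nonneg) auto
      ultimately show ?thesis by (simp add: mult_le_cancel_left1)
    qed
    also have "\<dots> \<le> hom_sum x"
      unfolding hom_sum_def mult.assoc
      by (rule member_le_sum[OF J(1)]) (auto intro!: mult_nonneg_nonneg prod_nonneg)
    finally have hs: "?n i powr (2 * colsum i) \<le> hom_sum x" .
    have "?n i powr (- s * colsum i / M) = (?n i powr (2 * colsum i)) powr (- s / (2 * M))"
      using M_ge_1 by (simp add: powr_powr field_simps)
    also have "\<dots> \<le> hom_sum x powr (- s / (2 * M))"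
      using hs s M_ge_1 by (intro powr_mono2 divide_nonneg_pos) auto
    also have "\<dots> = 1 / rpow (hom_norm k \<alpha> b x) s"
      using hom_norm_pos[OF gen] M_ge_1
      by (simp add: rpow_pos hom_norm_eq powr_powr powr_minus_divide)
    finally have h: "?n i powr (- s * colsum i / M) \<le> 1 / rpow (hom_norm k \<alpha> b x) s" .
    have "(\<Prod>j=1..k. rpow (?n j) (\<mu> j)) = ?n i powr \<mu> i * (\<Prod>j\<in>{1..k} - {i}. ?n j powr \<mu> j)"
      using n0 i by (subst prod.remove[of _ i]) (auto simp: rpow_pos)
    moreover have "c \<le> (\<Prod>j\<in>{1..k} - {i}. ?n j powr \<mu> j)"
      unfolding c_def using n1 nB by (intro prod_mono) (auto intro: powr_ge_powr_neg_abs)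
    then have "?n i powr \<mu> i * c \<le> ?n i powr \<mu> i * (\<Prod>j\<in>{1..k} - {i}. ?n j powr \<mu> j)"
      by (rule mult_left_mono) simp
    ultimately have pr: "?n i powr \<mu> i * c \<le> (\<Prod>j=1..k. rpow (?n j) (\<mu> j))"
      by simp
    have "c * ?n i powr (- real (block_dim b i)) \<le> c * ?n i powr (\<mu> i + - s * colsum i / M)"
      using ni c ex by (intro mult_left_mono powr_mono') auto
    also have "\<dots> = (?n i powr \<mu> i * c) * ?n i powr (- s * colsum i / M)"
      unfolding powr_add by (simp only: mult_ac)
    also have "\<dots> \<le> (\<Prod>j=1..k. rpow (?n j) (\<mu> j)) * (1 / rpow (hom_norm k \<alpha> b x) s)"
      using pr h c by (intro mult_mono) (auto intro!: prod_nonneg simp: rpow_nonneg)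
    finally show ?thesis by (simp add: hweight_def)
  qed
  from that[OF c bound] show ?thesis .
qed

text \<open>A slab with \<open>max R 1\<close> as its parameter lies outside the ball, because a
  block other than \<open>i\<close> has a coordinate beyond \<open>R\<close>; by
  \<open>hweight_slab_ge\<close> the integral over it already diverges.\<close>

lemma nn_integral_hweight_outside_ball:
  assumes par: "\<And>i. i \<in> {1..k} \<Longrightarrow> s < real (block_dim b i) + \<mu> i" and neg: "hconst s \<mu> < 0"
  shows "(\<integral>\<^sup>+x. ennreal (hweight s \<mu> x) * indicator {x. norm x > R} x \<partial>lborel) = \<infinity>"
proof -
  obtain i where i: "i \<in> {1..k}" "real (block_dim b i) + \<mu> i \<le> s * colsum i / M"
    and s: "s < 0" and k: "1 < k"
    using hconst_neg_exponent[OF par neg] by blast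
  define R' where "R' = max R 1"
  obtain c where c: "c > 0" and le: "\<And>x. x \<in> slab i R' 0 1 \<Longrightarrow>
     c * norm (block b i x) powr (- real (block_dim b i)) \<le> hweight s \<mu> x"
    using hweight_slab_ge[of i \<mu> s R', OF i s k] by (auto simp: R'_def)
  define J where "J = (if i = 1 then 2 else 1 :: nat)"
  have J: "J \<in> {1..k}" "J \<noteq> i" using k by (auto simp: J_def)
  from b_surj[OF J(1)] obtain a where a: "b a = J" by blast
  have far: "norm x > R" if "x \<in> slab i R' 0 1" for x
  proof -
    have "R' < x $ a" using that a J by (auto simp: slab_def)
    also have "\<dots> \<le> norm x" using component_le_norm_cart[of x a] by linarith
    finally show ?thesis by (simp add: R'_def)
  qed
  have [measurable]: "slab i R' 0 1 \<in> sets borel"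
    using open_slab by (rule borel_open)
  have "\<infinity> = ennreal c * (\<integral>\<^sup>+x. ennreal (norm (block b i x) powr (- real (block_dim b i))) *
     indicator (slab i R' 0 1) x \<partial>lborel)"
    unfolding nn_integral_slab_top[OF i(1)] using c by (simp add: ennreal_mult_top)
  also have "\<dots> = (\<integral>\<^sup>+x. ennreal c * (ennreal (norm (block b i x) powr (- real (block_dim b i))) *
     indicator (slab i R' 0 1) x) \<partial>lborel)"
    by (rule nn_integral_cmult[symmetric]) measurable
  also have "\<dots> \<le> (\<integral>\<^sup>+x. ennreal (hweight s \<mu> x) * indicator {x. norm x > R} x \<partial>lborel)"
    using le far c by (intro nn_integral_mono)
      (auto simp: indicator_def intro!: ennreal_leI simp flip: ennreal_mult')
  finally show ?thesis by (simp add: top_unique)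
qed

text \<open>If the constant is negative (possible only for \<open>s < 0\<close>), the dilation argument runs towards
  the origin and bounds \<open>\<phi> - \<phi> 0\<close>; then \<open>\<phi> 0 \<noteq> 0\<close> makes the right-hand side infinite.\<close>

lemma hardy_C01:
  assumes p: "p > 1" and par: "\<And>i. i \<in> {1..k} \<Longrightarrow> s < real (block_dim b i) + \<mu> i"
    and \<phi>: "\<phi> \<in> C01 \<Omega>"
  shows "ennreal ((hconst s \<mu> / p) powr p) * (\<integral>\<^sup>+x. ennreal (hweight s \<mu> x * \<bar>\<phi> x\<bar> powr p) \<partial>lborel)
      \<le> (\<integral>\<^sup>+x. ennreal (hardy_weight k \<alpha> b p s \<mu> x * norm (grad_lam k \<alpha> b \<phi> x) powr p) \<partial>lborel)"
    (is "?L \<le> ?R")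
proof -
  let ?C = "hconst s \<mu>"
  have R: "(\<integral>\<^sup>+x. ennreal (hweight s \<mu> x * \<bar>euler \<phi> x\<bar> powr p) \<partial>lborel) \<le> ?R"
    using AE_gen by (intro nn_integral_mono_AE)
      (auto elim!: eventually_mono intro!: ennreal_leI hweight_euler_le p)
  note hd = hardy_dilation[OF p _ _ _ C01_continuous[OF \<phi>] continuous_euler[OF \<phi>] DERIV_dil[OF \<phi>]]
  consider "?C = 0" | "?C > 0" | "?C < 0" by linarith
  then show ?thesis
  proof cases
    case 1
    then show ?thesis by simp
  next
    case 2
    \<comment> \<open>The origin is excluded because it is fixed by the dilations.\<close>
    have "AE x in lborel. x \<noteq> (0::real^'n)"
      using AE_lborel_singleton by (auto elim: eventually_mono)
    then have "AE x in lborel. ((\<lambda>t. \<phi> (dil (1 * t) x)) \<longlongrightarrow> 0) at_top"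
      by eventually_elim (use tendsto_dil_at_top[OF \<phi>] in simp)
    then have "?L \<le> (\<integral>\<^sup>+x. ennreal (hweight s \<mu> x * \<bar>euler \<phi> x\<bar> powr p) \<partial>lborel)"
      using hd[of "?C / p" 1 s \<mu> 0] 2 p by simp
    then show ?thesis using R by (rule order_trans)
  next
    case 3
    have eq: "(?C / p) powr p = (- ?C / p) powr p"
      by (metis minus_divide_left uminus_powr_eq)
    have *: "ennreal ((?C / p) powr p) * (\<integral>\<^sup>+x. ennreal (hweight s \<mu> x * \<bar>\<phi> x - \<phi> 0\<bar> powr p) \<partial>lborel) \<le> ?R"
      using hd[of "- ?C / p" "-1" s \<mu> "\<phi> 0"] 3 p tendsto_dil_at_bot[OF \<phi>] R
      unfolding eq by (auto simp: divide_pos_neg divide_neg_pos intro: order_trans)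
    show ?thesis
    proof (cases "\<phi> 0 = 0")
      case True
      then show ?thesis using * by simp
    next
      case False
      obtain r where r: "r > 0" "\<And>x. norm x > r \<Longrightarrow> \<phi> x = 0"
        using C01_bounded_support[OF \<phi>] by blast
      \<comment> \<open>Outside the ball of radius \<open>r\<close> the difference
        \<open>\<phi> x - \<phi> 0\<close> is the nonzero constant \<open>- \<phi> 0\<close>, so the
        left-hand side of \<open>*\<close> is infinite.\<close>
      have "(\<integral>\<^sup>+x. ennreal (hweight s \<mu> x) * indicator {x. norm x > r} x \<partial>lborel) = \<infinity>"
        by (rule nn_integral_hweight_outside_ball) (use par 3 in auto)
      then have "\<infinity> = ennreal (\<bar>\<phi> 0\<bar> powr p) *
          (\<integral>\<^sup>+x. ennreal (hweight s \<mu> x) * indicator {x. norm x > r} x \<partial>lborel)"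
        using False by (simp add: ennreal_mult_top)
      also have "\<dots> = (\<integral>\<^sup>+x. ennreal (\<bar>\<phi> 0\<bar> powr p) *
          (ennreal (hweight s \<mu> x) * indicator {x. norm x > r} x) \<partial>lborel)"
        by (rule nn_integral_cmult[symmetric]) measurable
      also have "\<dots> \<le> (\<integral>\<^sup>+x. ennreal (hweight s \<mu> x * \<bar>\<phi> x - \<phi> 0\<bar> powr p) \<partial>lborel)"
        using r(2) by (intro nn_integral_mono)
          (auto simp: indicator_def hweight_nonneg ennreal_mult mult.commute)
      finally have "(\<integral>\<^sup>+x. ennreal (hweight s \<mu> x * \<bar>\<phi> x - \<phi> 0\<bar> powr p) \<partial>lborel) = \<infinity>"
        by (simp add: top_unique)
      with * 3 p have "?R = \<infinity>"
        by (simp add: ennreal_mult_top top_unique)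
      then show ?thesis by simp
    qed
  qed
qed

end

section \<open>Passage to the completion\<close>

lemma measurable_lebesgue_on: "f \<in> borel_measurable borel \<Longrightarrow> f \<in> borel_measurable (lebesgue_on \<Omega>)"
  by (intro measurable_restrict_space1 measurable_completion) simp

context block_splitting
begin

lemma hardy_weight_nonneg: "hardy_weight k \<alpha> b p s \<mu> x \<ge> 0"
  by (simp add: hardy_weight_def prod_nonneg rpow_nonneg)

lemma measurable_hardy_weight [measurable]: "hardy_weight k \<alpha> b p s \<mu> \<in> borel_measurable borel"
  unfolding hardy_weight_def[abs_def] by measurable

lemma measurable_grad_lam:
  assumes "\<phi> \<in> C01 \<Omega>" shows "grad_lam k \<alpha> b \<phi> \<in> borel_measurable borel"
proof -
  have [measurable]: "(\<lambda>x. frechet_derivative \<phi> (at x) (axis a 1)) \<in> borel_measurable borel" for a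
    using assms unfolding C01_def by (auto intro: borel_measurable_continuous_onI)
  show ?thesis
    unfolding grad_lam_def[abs_def] by (intro measurable_vec_lambda) measurable
qed

text \<open>Points outside \<Omega> lie in the open complement of the closed support, near which
  \<phi> vanishes. Hence the gradient integral over the whole space is the one over
  \<Omega>.\<close>

lemma C01_zero_outside:
  assumes \<phi>: "\<phi> \<in> C01 \<Omega>" and x: "x \<notin> \<Omega>"
  shows "grad_lam k \<alpha> b \<phi> x = 0"
proof -
  have x: "x \<in> - closure {x. \<phi> x \<noteq> 0}" using assms by (auto simp: C01_def)
  have "(\<phi> has_derivative (\<lambda>_. 0)) (at x)"
    using has_derivative_const[of 0 "at x"] _ x
    by (rule has_derivative_transform_within_open[where s = "- closure {x. \<phi> x \<noteq> 0}"])
       (use closure_subset[of "{x. \<phi> x \<noteq> 0}"] in auto)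
  then have "frechet_derivative \<phi> (at x) = (\<lambda>_. 0)"
    by (rule frechet_derivative_at[symmetric])
  then show ?thesis by (simp add: grad_lam_def vec_eq_iff)
qed

lemma wnorm_pow_lebesgue_on:
  assumes "open \<Omega>"
  shows "wnorm_pow p \<Omega> \<psi> G = (\<integral>\<^sup>+x. ennreal (\<psi> x * norm (G x) powr p) \<partial>lebesgue_on \<Omega>)"
  unfolding wnorm_pow_def using assms by (subst nn_integral_restrict_space) auto

lemma hardy_C01_lebesgue_on:
  assumes \<Omega>: "open \<Omega>" and p: "p > 1" and par: "\<And>i. i \<in> {1..k} \<Longrightarrow> s < real (block_dim b i) + \<mu> i"
    and \<phi>: "\<phi> \<in> C01 \<Omega>"
  shows "(\<integral>\<^sup>+x. ennreal ((hconst s \<mu> / p) powr p * (hweight s \<mu> x * \<bar>\<phi> x\<bar> powr p)) \<partial>lebesgue_on \<Omega>)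
      \<le> wnorm_pow p \<Omega> (hardy_weight k \<alpha> b p s \<mu>) (grad_lam k \<alpha> b \<phi>)"
proof -
  have [measurable]: "\<phi> \<in> borel_measurable borel"
    using C01_continuous[OF \<phi>] by (rule borel_measurable_continuous_onI)
  have "(\<integral>\<^sup>+x. ennreal ((hconst s \<mu> / p) powr p * (hweight s \<mu> x * \<bar>\<phi> x\<bar> powr p)) \<partial>lebesgue_on \<Omega>)
      = (\<integral>\<^sup>+x\<in>\<Omega>. ennreal ((hconst s \<mu> / p) powr p * (hweight s \<mu> x * \<bar>\<phi> x\<bar> powr p)) \<partial>lebesgue)"
    using \<Omega> by (subst nn_integral_restrict_space) auto
  also have "\<dots> \<le> (\<integral>\<^sup>+x. ennreal ((hconst s \<mu> / p) powr p * (hweight s \<mu> x * \<bar>\<phi> x\<bar> powr p)) \<partial>lebesgue)"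
    by (intro nn_integral_mono) (auto simp: indicator_def)
  also have "\<dots> = ennreal ((hconst s \<mu> / p) powr p) * (\<integral>\<^sup>+x. ennreal (hweight s \<mu> x * \<bar>\<phi> x\<bar> powr p) \<partial>lborel)"
    unfolding nn_integral_completion
    by (subst nn_integral_cmult[symmetric]) (auto simp: ennreal_mult' hweight_nonneg)
  also have "\<dots> \<le> (\<integral>\<^sup>+x. ennreal (hardy_weight k \<alpha> b p s \<mu> x * norm (grad_lam k \<alpha> b \<phi> x) powr p) \<partial>lborel)"
    by (rule hardy_C01[OF p _ \<phi>]) (rule par)
  also have "\<dots> = wnorm_pow p \<Omega> (hardy_weight k \<alpha> b p s \<mu>) (grad_lam k \<alpha> b \<phi>)"
    unfolding wnorm_pow_def nn_integral_completion
    using p by (intro nn_integral_cong) (auto simp: indicator_def C01_zero_outside[OF \<phi>])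
  finally show ?thesis .
qed

text \<open>A substitute for Minkowski's inequality, obtained by integrating
  \<open>powr_add_le\<close>; it avoids taking \<open>p\<close>-th roots of extended values.\<close>

lemma wnorm_pow_triangle:
  assumes \<Omega>: "open \<Omega>" and p: "p > 1" and \<theta>: "0 < \<theta>" "\<theta> < 1"
    and \<psi>: "\<psi> \<in> borel_measurable borel" "\<And>x. \<psi> x \<ge> 0"
    and F [measurable]: "F \<in> borel_measurable (lebesgue_on \<Omega>)"
    and G [measurable]: "G \<in> borel_measurable (lebesgue_on \<Omega>)"
  shows "wnorm_pow p \<Omega> \<psi> F \<le> ennreal ((1 - \<theta>) powr (1 - p)) * wnorm_pow p \<Omega> \<psi> G
     + ennreal (\<theta> powr (1 - p)) * wnorm_pow p \<Omega> \<psi> (\<lambda>x. F x - G x)"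
proof -
  have [measurable]: "\<psi> \<in> borel_measurable (lebesgue_on \<Omega>)"
    using \<psi>(1) by (rule measurable_lebesgue_on)
  have pt: "\<psi> x * norm (F x) powr p \<le> (1 - \<theta>) powr (1 - p) * (\<psi> x * norm (G x) powr p)
      + \<theta> powr (1 - p) * (\<psi> x * norm (F x - G x) powr p)" for x
  proof -
    have "norm (F x) powr p \<le> (norm (G x) + norm (F x - G x)) powr p"
      using norm_triangle_sub[of "F x" "G x"] p by (intro powr_mono2) auto
    also have "\<dots> \<le> (1 - \<theta>) powr (1 - p) * norm (G x) powr p + \<theta> powr (1 - p) * norm (F x - G x) powr p"
      by (rule powr_add_le) (use p \<theta> in auto)
    finally have "\<psi> x * norm (F x) powr p \<le>
        \<psi> x * ((1 - \<theta>) powr (1 - p) * norm (G x) powr p + \<theta> powr (1 - p) * norm (F x - G x) powr p)"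
      using \<psi>(2) by (rule mult_left_mono)
    then show ?thesis by (simp add: algebra_simps)
  qed
  have "wnorm_pow p \<Omega> \<psi> F \<le> (\<integral>\<^sup>+x. ennreal ((1 - \<theta>) powr (1 - p)) * ennreal (\<psi> x * norm (G x) powr p)
      + ennreal (\<theta> powr (1 - p)) * ennreal (\<psi> x * norm (F x - G x) powr p) \<partial>lebesgue_on \<Omega>)"
    unfolding wnorm_pow_lebesgue_on[OF \<Omega>] using pt \<psi>(2)
    by (intro nn_integral_mono) (simp flip: ennreal_mult' ennreal_plus)
  also have "\<dots> = ennreal ((1 - \<theta>) powr (1 - p)) * wnorm_pow p \<Omega> \<psi> G
     + ennreal (\<theta> powr (1 - p)) * wnorm_pow p \<Omega> \<psi> (\<lambda>x. F x - G x)"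
    unfolding wnorm_pow_lebesgue_on[OF \<Omega>]
    by (subst nn_integral_add) (auto simp: nn_integral_cmult)
  finally show ?thesis .
qed

text \<open>Fatou's lemma treats the left-hand side along the approximating \<open>\<phi> n\<close>.
  On the right, \<open>wnorm_pow_triangle\<close> bounds the lower limit of the gradient integrals
  by \<open>(1 - \<theta>) powr (1 - p)\<close> times that of \<open>G\<close>, for each \<theta>
  between \<open>0\<close> and \<open>1\<close>.\<close>

theorem hardy_W0:
  assumes \<Omega>: "open \<Omega>" and p: "p > 1" and par: "hardy_params k \<alpha> b p s \<mu>"
    and W0: "(u, G) \<in> W0 k \<alpha> b p \<Omega> (hardy_weight k \<alpha> b p s \<mu>)"
  shows "ennreal ((hconst s \<mu> / p) powr p) *
      (\<integral>\<^sup>+x\<in>\<Omega>. ennreal (hweight s \<mu> x * \<bar>u x\<bar> powr p) \<partial>lebesgue)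
    \<le> (\<integral>\<^sup>+x\<in>\<Omega>. ennreal (hardy_weight k \<alpha> b p s \<mu> x * norm (G x) powr p) \<partial>lebesgue)"
proof -
  let ?\<psi> = "hardy_weight k \<alpha> b p s \<mu>" and ?c = "(hconst s \<mu> / p) powr p"
  have u [measurable]: "u \<in> borel_measurable (lebesgue_on \<Omega>)"
    and G: "G \<in> borel_measurable (lebesgue_on \<Omega>)"
    using W0 by (auto simp: W0_def)
  from W0 obtain \<phi> where \<phi>: "\<And>n. \<phi> n \<in> C01 \<Omega>"
    and lim: "(\<lambda>n. wnorm_pow p \<Omega> ?\<psi> (\<lambda>x. grad_lam k \<alpha> b (\<phi> n) x - G x)) \<longlonglongrightarrow> 0"
    and ae: "AE x\<in>\<Omega> in lebesgue. (\<lambda>n. \<phi> n x) \<longlonglongrightarrow> u x"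
    by (auto simp: W0_def)
  let ?g = "\<lambda>v x. ennreal (?c * (hweight s \<mu> x * \<bar>v x\<bar> powr p))"
  have [measurable]: "\<phi> n \<in> borel_measurable (lebesgue_on \<Omega>)" for n
    using C01_continuous[OF \<phi>] by (intro measurable_lebesgue_on borel_measurable_continuous_onI)
  have [measurable]: "hweight s \<mu> \<in> borel_measurable (lebesgue_on \<Omega>)"
    by (intro measurable_lebesgue_on) measurable
  have "AE x in lebesgue_on \<Omega>. (\<lambda>n. \<phi> n x) \<longlonglongrightarrow> u x"
    using ae \<Omega> by (subst AE_restrict_space_iff) auto
  then have liminf: "AE x in lebesgue_on \<Omega>. ?g u x = liminf (\<lambda>n. ?g (\<phi> n) x)"
  proof eventually_elim
    case (elim x)
    have "(\<lambda>n. ?g (\<phi> n) x) \<longlonglongrightarrow> ?g u x"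
      by (intro tendsto_ennrealI tendsto_mult tendsto_const tendsto_powr' tendsto_rabs elim) (use p in auto)
    then show ?case by (simp add: lim_imp_Liminf)
  qed
  have "ennreal ?c * (\<integral>\<^sup>+x\<in>\<Omega>. ennreal (hweight s \<mu> x * \<bar>u x\<bar> powr p) \<partial>lebesgue)
     = ennreal ?c * (\<integral>\<^sup>+x. ennreal (hweight s \<mu> x * \<bar>u x\<bar> powr p) \<partial>lebesgue_on \<Omega>)"
    using \<Omega> by (subst nn_integral_restrict_space) auto
  also have "\<dots> = (\<integral>\<^sup>+x. ?g u x \<partial>lebesgue_on \<Omega>)"
    by (subst nn_integral_cmult[symmetric]) (auto simp: ennreal_mult' hweight_nonneg)
  also have "\<dots> = (\<integral>\<^sup>+x. liminf (\<lambda>n. ?g (\<phi> n) x) \<partial>lebesgue_on \<Omega>)"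
    using liminf by (rule nn_integral_cong_AE)
  also have "\<dots> \<le> liminf (\<lambda>n. \<integral>\<^sup>+x. ?g (\<phi> n) x \<partial>lebesgue_on \<Omega>)"
    by (rule nn_integral_liminf) measurable
  also have "\<dots> \<le> liminf (\<lambda>n. wnorm_pow p \<Omega> ?\<psi> (grad_lam k \<alpha> b (\<phi> n)))"
    using hardy_C01_lebesgue_on[OF \<Omega> p _ \<phi>] hardy_params_less[OF par p]
    by (intro Liminf_mono always_eventually) auto
  also have "\<dots> \<le> wnorm_pow p \<Omega> ?\<psi> G"
  proof -
    let ?L = "liminf (\<lambda>n. wnorm_pow p \<Omega> ?\<psi> (grad_lam k \<alpha> b (\<phi> n)))"
    have le: "?L \<le> ennreal ((1 - \<theta>) powr (1 - p)) * wnorm_pow p \<Omega> ?\<psi> G" if \<theta>: "0 < \<theta>" "\<theta> < 1" for \<theta>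
    proof -
      let ?b = "\<lambda>n. ennreal ((1 - \<theta>) powr (1 - p)) * wnorm_pow p \<Omega> ?\<psi> G
        + ennreal (\<theta> powr (1 - p)) * wnorm_pow p \<Omega> ?\<psi> (\<lambda>x. grad_lam k \<alpha> b (\<phi> n) x - G x)"
      have "?b \<longlonglongrightarrow> ennreal ((1 - \<theta>) powr (1 - p)) * wnorm_pow p \<Omega> ?\<psi> G + ennreal (\<theta> powr (1 - p)) * 0"
        by (intro tendsto_add tendsto_const ennreal_tendsto_cmult lim) auto
      then have "liminf ?b = ennreal ((1 - \<theta>) powr (1 - p)) * wnorm_pow p \<Omega> ?\<psi> G"
        by (simp add: lim_imp_Liminf)
      moreover have "?L \<le> liminf ?b"
        by (intro Liminf_mono always_eventually allI wnorm_pow_triangle \<Omega> p \<theta> G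
            measurable_hardy_weight hardy_weight_nonneg measurable_lebesgue_on measurable_grad_lam[OF \<phi>])
      ultimately show ?thesis by simp
    qed
    \<comment> \<open>Letting \<theta> tend to \<open>0\<close> recovers the factor
      \<open>1\<close>; the product converges because the integral for \<open>G\<close> is
      finite.\<close>
    have "((\<lambda>\<theta>::real. (1 - \<theta>) powr (1 - p)) \<longlongrightarrow> (1 - 0) powr (1 - p)) (at_right 0)"
      by (intro tendsto_intros) auto
    then have "((\<lambda>\<theta>. wnorm_pow p \<Omega> ?\<psi> G * ennreal ((1 - \<theta>) powr (1 - p)))
        \<longlongrightarrow> wnorm_pow p \<Omega> ?\<psi> G * ennreal ((1 - 0) powr (1 - p))) (at_right 0)"
      using W0 by (intro ennreal_tendsto_cmult tendsto_ennrealI) (auto simp: W0_def)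
    then have "?L \<le> wnorm_pow p \<Omega> ?\<psi> G * ennreal ((1 - 0) powr (1 - p))"
      by (rule tendsto_lowerbound)
        (auto simp: eventually_at_right_field mult.commute intro!: exI[of _ 1] le)
    then show ?thesis by simp
  qed
  finally show ?thesis by (simp add: wnorm_pow_def)
qed

section \<open>The two special choices of the parameters\<close>

lemma prod_rpow_colsum:
  assumes "x \<in> gen"
  shows "(\<Prod>i=1..k. rpow (norm (block b i x)) (p * (\<Sum>j=1..k. \<alpha> j i))) = (\<Prod>i=1..k. lam k \<alpha> b i x powr p)"
proof -
  have "(\<Prod>i=1..k. lam k \<alpha> b i x powr p) = (\<Prod>j=1..k. (norm (block b j x) powr colsum j) powr p)"
    by (simp only: prod_powr_distrib[symmetric] prod_lam[OF assms])
  then show ?thesis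
    using assms by (auto simp: rpow_pos gen_def powr_powr colsum_def mult.commute intro!: prod.cong)
qed

end
theorem theorem1:
  fixes b :: "'n::finite \<Rightarrow> nat" and k :: nat and \<alpha> :: "nat \<Rightarrow> nat \<Rightarrow> real"
    and \<Omega> :: "(real^'n) set" and p :: real
  assumes "b ` UNIV = {1..k}"
    and "CARD('n) \<ge> 3"
    and "\<forall>i\<in>{1..k}. \<forall>j\<in>{1..k}. \<alpha> i j \<ge> 0"
    and "\<forall>i\<in>{1..k}. \<forall>j\<in>{1..k}. j \<ge> i \<longrightarrow> \<alpha> i j = 0"
    and "\<forall>i\<in>{1..k}. \<forall>j\<in>{1..k}. i \<noteq> j \<longrightarrow> lam k \<alpha> b i \<noteq> lam k \<alpha> b j"
    and "open \<Omega>"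
    and "p > 1"
  shows
    "(\<forall>s \<mu>. hardy_params k \<alpha> b p s \<mu> \<longrightarrow>
       (\<forall>(u, Du) \<in> W0 k \<alpha> b p \<Omega> (hardy_weight k \<alpha> b p s \<mu>).
          ennreal (((hom_dim k \<alpha> b - s + (\<Sum>i=1..k. sigma \<alpha> i * \<mu> i)) / p) powr p) *
            (\<integral>\<^sup>+x\<in>\<Omega>. ennreal ((\<Prod>i=1..k. rpow (norm (block b i x)) (\<mu> i)) /
                 rpow (hom_norm k \<alpha> b x) s * \<bar>u x\<bar> powr p) \<partial>lebesgue)
          \<le> (\<integral>\<^sup>+x\<in>\<Omega>. ennreal (hardy_weight k \<alpha> b p s \<mu> x * norm (Du x) powr p) \<partial>lebesgue)))
     \<and>
     (hardy_params k \<alpha> b p p (\<lambda>i. 0) \<longrightarrow>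
       (\<forall>(u, Du) \<in> W0 k \<alpha> b p \<Omega> (hardy_weight k \<alpha> b p p (\<lambda>i. 0)).
          ennreal (((hom_dim k \<alpha> b - p) / p) powr p) *
            (\<integral>\<^sup>+x\<in>\<Omega>. ennreal (\<bar>u x\<bar> powr p / hom_norm k \<alpha> b x powr p) \<partial>lebesgue)
          \<le> (\<integral>\<^sup>+x\<in>\<Omega>. ennreal (rpow (hom_norm k \<alpha> b x) (p * (\<Sum>i=1..k. sigma \<alpha> i - 1)) /
                 (\<Prod>i=1..k. lam k \<alpha> b i x powr p) * norm (Du x) powr p) \<partial>lebesgue)))
     \<and>
     (let s = p * (1 + (\<Sum>i=1..k. sigma \<alpha> i - 1)); \<mu> = (\<lambda>i. p * (\<Sum>j=1..k. \<alpha> j i)) in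
       hardy_params k \<alpha> b p s \<mu> \<longrightarrow>
       (\<forall>(u, Du) \<in> W0 k \<alpha> b p \<Omega> (hardy_weight k \<alpha> b p s \<mu>).
          ennreal (((hom_dim k \<alpha> b - p) / p) powr p) *
            (\<integral>\<^sup>+x\<in>\<Omega>. ennreal ((\<Prod>i=1..k. lam k \<alpha> b i x powr p) /
                 hom_norm k \<alpha> b x powr (p * (1 + (\<Sum>i=1..k. sigma \<alpha> i - 1))) *
                 \<bar>u x\<bar> powr p) \<partial>lebesgue)
          \<le> (\<integral>\<^sup>+x\<in>\<Omega>. ennreal (norm (Du x) powr p) \<partial>lebesgue)))"
proof -
  interpret block_splitting b k \<alpha>
    using assms(1,3,4) by unfold_locales auto
  have gen: "AE x in lebesgue. x \<in> gen"
    using AE_gen by (rule AE_completion)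
  have general: "ennreal (((hom_dim k \<alpha> b - s + (\<Sum>i=1..k. sigma \<alpha> i * \<mu> i)) / p) powr p) *
            (\<integral>\<^sup>+x\<in>\<Omega>. ennreal ((\<Prod>i=1..k. rpow (norm (block b i x)) (\<mu> i)) /
                 rpow (hom_norm k \<alpha> b x) s * \<bar>u x\<bar> powr p) \<partial>lebesgue)
          \<le> (\<integral>\<^sup>+x\<in>\<Omega>. ennreal (hardy_weight k \<alpha> b p s \<mu> x * norm (Du x) powr p) \<partial>lebesgue)"
    if "hardy_params k \<alpha> b p s \<mu>" "(u, Du) \<in> W0 k \<alpha> b p \<Omega> (hardy_weight k \<alpha> b p s \<mu>)" for s \<mu> u Du
    using hardy_W0[OF assms(6,7) that] unfolding hconst_def hweight_def .
  have "ennreal (((hom_dim k \<alpha> b - p) / p) powr p) *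
            (\<integral>\<^sup>+x\<in>\<Omega>. ennreal (\<bar>u x\<bar> powr p / hom_norm k \<alpha> b x powr p) \<partial>lebesgue)
          \<le> (\<integral>\<^sup>+x\<in>\<Omega>. ennreal (rpow (hom_norm k \<alpha> b x) (p * (\<Sum>i=1..k. sigma \<alpha> i - 1)) /
                 (\<Prod>i=1..k. lam k \<alpha> b i x powr p) * norm (Du x) powr p) \<partial>lebesgue)"
    if par: "hardy_params k \<alpha> b p p (\<lambda>i. 0)"
      and W: "(u, Du) \<in> W0 k \<alpha> b p \<Omega> (hardy_weight k \<alpha> b p p (\<lambda>i. 0))" for u Du
  proof -
    have "hardy_weight k \<alpha> b p p (\<lambda>i. 0) x = rpow (hom_norm k \<alpha> b x) (p * (\<Sum>i=1..k. sigma \<alpha> i - 1)) /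
                 (\<Prod>i=1..k. lam k \<alpha> b i x powr p)" if "x \<in> gen" for x
    proof -
      have "p * (1 + (\<Sum>i=1..k. sigma \<alpha> i - 1)) - p = p * (\<Sum>i=1..k. sigma \<alpha> i - 1)"
        by (simp add: distrib_left)
      then show ?thesis
        unfolding hardy_weight_def diff_0_right prod_rpow_colsum[OF that] by (rule arg_cong)
    qed
    then have "(\<integral>\<^sup>+x\<in>\<Omega>. ennreal (hardy_weight k \<alpha> b p p (\<lambda>i. 0) x * norm (Du x) powr p) \<partial>lebesgue)
        = (\<integral>\<^sup>+x\<in>\<Omega>. ennreal (rpow (hom_norm k \<alpha> b x) (p * (\<Sum>i=1..k. sigma \<alpha> i - 1)) /
                 (\<Prod>i=1..k. lam k \<alpha> b i x powr p) * norm (Du x) powr p) \<partial>lebesgue)"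
      using gen by (intro nn_integral_cong_AE) (auto elim!: eventually_mono)
    \<comment> \<open>The statement uses \<open>powr\<close> here, which agrees with
      \<open>rpow\<close> because \<open>p\<close> is not \<open>0\<close>; the factors with
      exponent \<open>\<mu> i = 0\<close> become \<open>1\<close>.\<close>
    moreover have "rpow h p = h powr p" for h
      using assms(7) by (simp add: rpow_def)
    moreover have "rpow t 0 = 1" for t
      by (simp add: rpow_def)
    ultimately show ?thesis
      using general[OF par W] by simp
  qed
  moreover have "ennreal (((hom_dim k \<alpha> b - p) / p) powr p) *
            (\<integral>\<^sup>+x\<in>\<Omega>. ennreal ((\<Prod>i=1..k. lam k \<alpha> b i x powr p) /
                 hom_norm k \<alpha> b x powr (p * (1 + (\<Sum>i=1..k. sigma \<alpha> i - 1))) *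
                 \<bar>u x\<bar> powr p) \<partial>lebesgue)
          \<le> (\<integral>\<^sup>+x\<in>\<Omega>. ennreal (norm (Du x) powr p) \<partial>lebesgue)"
    if s: "s = p * (1 + (\<Sum>i=1..k. sigma \<alpha> i - 1))" and \<mu>: "\<mu> = (\<lambda>i. p * (\<Sum>j=1..k. \<alpha> j i))"
      and par: "hardy_params k \<alpha> b p s \<mu>"
      and W: "(u, Du) \<in> W0 k \<alpha> b p \<Omega> (hardy_weight k \<alpha> b p s \<mu>)" for s \<mu> u Du
  proof -
    have sM: "s = p * M" by (simp add: s M_def)
    then have s0: "s \<noteq> 0" using assms(7) M_ge_1 by simp
    \<comment> \<open>By \<open>M_eq_colsum\<close> this sum is \<open>p * (M - 1)\<close>, so with
      \<open>s = p * M\<close> the constant becomes \<open>hom_dim k \<alpha> b - p\<close>.\<close>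
    have "(\<Sum>i=1..k. \<sigma> i * \<mu> i) = p * (\<Sum>j=1..k. colsum j * \<sigma> j)"
      by (simp add: \<mu> colsum_def sum_distrib_left mult_ac)
    then have const: "hom_dim k \<alpha> b - s + (\<Sum>i=1..k. sigma \<alpha> i * \<mu> i) = hom_dim k \<alpha> b - p"
      by (simp add: sM M_eq_colsum algebra_simps)
    \<comment> \<open>All exponents in the weight are \<open>0\<close>, so the convention
      \<open>rpow t 0 = 1\<close> gives the value at every point, not only on
      \<open>gen\<close>.\<close>
    have weight: "hardy_weight k \<alpha> b p s \<mu> x = 1" for x
      by (simp add: hardy_weight_def s \<mu> rpow_def)
    have "(\<integral>\<^sup>+x\<in>\<Omega>. ennreal ((\<Prod>i=1..k. rpow (norm (block b i x)) (\<mu> i)) /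
                 rpow (hom_norm k \<alpha> b x) s * \<bar>u x\<bar> powr p) \<partial>lebesgue)
        = (\<integral>\<^sup>+x\<in>\<Omega>. ennreal ((\<Prod>i=1..k. lam k \<alpha> b i x powr p) /
                 hom_norm k \<alpha> b x powr s * \<bar>u x\<bar> powr p) \<partial>lebesgue)"
      using gen s0 by (intro nn_integral_cong_AE)
        (auto elim!: eventually_mono simp: \<mu> prod_rpow_colsum[simplified] rpow_def[of _ s])
    then show ?thesis
      using general[OF par W] unfolding const weight by (simp add: s)
  qed
  ultimately show ?thesis
    using general unfolding Let_def by blast
qed

end
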